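(* Let $\alpha\in(0,1)$ be fixed. Suppose that $n_1\asymp n_2\asymp n$, that $\log q=O(n^{1/3-\epsilon})$ for some (arbitrary) $0<\epsilon<1/3$, and that $\zeta_{a,ij}>r_a>0$ for $a=1,2$ and all $1\le i,j\le q$, with constants $r_1,r_2$ not depending on $i,j$. Then, as $n,q\to\infty$, $$\inf_{(\mathbf U_1,\mathbf U_2)\in\mathbb A(4)}\mathbb P(\mathrm T_\alpha=1)\to1,$$ where the infimum is over the distributions of $\boldsymbol X,\boldsymbol Y$ (satisfying the conditions just listed) for which $(\mathbf U_1,\mathbf U_2)\in\mathbb A(4)$.
   Context: Setting. $\boldsymbol X,\boldsymbol Y$ are random vectors in $\mathbb R^d$; $\boldsymbol X_1,\dots,\boldsymbol X_{n_1}$ are i.i.d. copies of $\boldsymbol X$ and $\boldsymbol Y_1,\dots,\boldsymbol Y_{n_2}$ are i.i.d. copies of $\boldsymbol Y$, the two samples being independent; $n:=\max\{n_1,n_2\}$. For $1\le i,j\le q$, $\Phi_{ij}:(\mathbb R^d)^m\to\mathbb R$ is a Borel kernel, symmetric in its $m$ arguments, with $\Phi_{ij}=\Phi_{ji}$, fixed order $m$, and bounded uniformly in $i,j$ (and along the asymptotic sequence). In asymptotic statements $n_1,n_2,d,q$, the laws of $\boldsymbol X,\boldsymbol Y$ and the kernels may vary along the sequence; the constants in the assumptions are fixed. $\widehat u_{1,ij}=\binom{n_1}{m}^{-1}\sum_{1\le \ell_1<\dots<\ell_m\le n_1}\Phi_{ij}(\boldsymbol X_{\ell_1},\dots,\boldsymbol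 X_{\ell_m})$, and $\widehat u_{2,ij}$ is the same with $\boldsymbol Y$, $n_2$. $u_{a,ij}=\mathbb E[\widehat u_{a,ij}]$, $\mathbf U_a=(u_{a,ij})_{1\le i,j\le q}$, $a=1,2$. Jackknife variance estimator: $\widehat\sigma^2(\widehat u_{1,ij})=\frac{m^2(n_1-1)}{n_1(n_1-m)^2}\sum_{\alpha=1}^{n_1}(q_{1\alpha,ij}-\widehat u_{1,ij})^2$ with $q_{1\alpha,ij}=\binom{n_1-1}{m-1}^{-1}\sum \Phi_{ij}(\boldsymbol X_\alpha,\boldsymbol X_{\ell_1},\dots,\boldsymbol X_{\ell_{m-1}})$, the sum over $1\le \ell_1<\dots<\ell_{m-1}\le n_1$ with all $\ell_k\ne\alpha$; $\widehat\sigma^2(\widehat u_{2,ij})$ is defined analogously from $\boldsymbol Y$, $n_2$. $M_n=\max_{1\le i,j\le q}\dfrac{(\widehat u_{1,ij}-\widehat u_{2,ij})^2}{\widehat\sigma^2(\widehat u_{1,ij})+\widehat\sigma^2(\widehat u_{2,ij})}$. Test: $\mathrm T_\alpha=\mathbb 1\{M_n\ge G^-(\alpha)+4\log q-\log(\log q)\}$ with $G^-(\alpha)=-\log(8\pi)-2\log(-\log(1-\alpha))$. $g_{ij}(\boldsymbol X_\ell)=\mathbb E[\Phi_{ij}(\boldsymbol X_{\ell_1},\dots,\boldsymbol X_{\ell_m})\mid \boldsymbol X_\ell]$ for distinct $\ell_1,\dots,\ell_m$ containing $\ell$, similarly for $\boldsymbol Y$; $\zeta_{1,ij}=\mathrm{Var}(g_{ij}(\boldsymbol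 X_\ell))$, $\zeta_{2,ij}=\mathrm{Var}(g_{ij}(\boldsymbol Y_\ell))$. For $C>0$: $\mathbb A(C)=\Big\{(\mathbf U_1,\mathbf U_2):\max_{1\le i,j\le q}\dfrac{|u_{1,ij}-u_{2,ij}|}{\sqrt{m^2\zeta_{1,ij}/n_1+m^2\zeta_{2,ij}/n_2}}\ge C\sqrt{\log q}\Big\}$. *)

theory Defs
  imports
    "HOL-Probability.Probability"
    "HOL-Combinatorics.Permutations"
    "HOL-Library.Landau_Symbols"
begin

text \<open>
  Since the dimension \<open>d\<close> varies along the asymptotic sequence, a vector of $R^d$ is a function
  \<open>nat \<Rightarrow> real\<close> that is extensional on \<open>{1..d}\<close>; the product sigma-algebra below is the Borel
  sigma-algebra of $R^d$.
\<close>

definition euclid :: "nat \<Rightarrow> (nat \<Rightarrow> real) measure" where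
  "euclid d = (\<Pi>\<^sub>M i\<in>{1..d}. (borel :: real measure))"

definition distribution_on :: "nat \<Rightarrow> (nat \<Rightarrow> real) measure \<Rightarrow> bool" where
  "distribution_on d \<mu> \<longleftrightarrow> prob_space \<mu> \<and> sets \<mu> = sets (euclid d)"

text \<open>
  A kernel takes an \<open>m\<close>-tuple of vectors, encoded as a function that is extensional on \<open>{1..m}\<close>.
  All conditions are relativised to such tuples.
\<close>

type_synonym kernel = "(nat \<Rightarrow> nat \<Rightarrow> real) \<Rightarrow> real"

definition kernel_family ::
    "nat \<Rightarrow> nat \<Rightarrow> nat \<Rightarrow> real \<Rightarrow> (nat \<Rightarrow> nat \<Rightarrow> kernel) \<Rightarrow> bool" where
  "kernel_family d m q B \<Phi> \<longleftrightarrow>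
    (\<forall>i\<in>{1..q}. \<forall>j\<in>{1..q}.
      \<Phi> i j \<in> borel_measurable (\<Pi>\<^sub>M l\<in>{1..m}. euclid d) \<and>
      (\<forall>x\<in>space (\<Pi>\<^sub>M l\<in>{1..m}. euclid d).
        (\<forall>p. p permutes {1..m} \<longrightarrow> \<Phi> i j (x \<circ> p) = \<Phi> i j x) \<and>
        \<Phi> i j x = \<Phi> j i x \<and>
        \<bar>\<Phi> i j x\<bar> \<le> B))"

definition increasing_tuples :: "nat \<Rightarrow> nat set \<Rightarrow> (nat \<Rightarrow> nat) set" where
  "increasing_tuples r A = {l \<in> {1..r} \<rightarrow>\<^sub>E A. strict_mono_on {1..r} l}"

definition ustat :: "nat \<Rightarrow> nat \<Rightarrow> kernel \<Rightarrow> (nat \<Rightarrow> nat \<Rightarrow> real) \<Rightarrow> real" where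
  "ustat n m \<phi> x =
    (\<Sum>l\<in>increasing_tuples m {1..n}. \<phi> (\<lambda>k\<in>{1..m}. x (l k))) / real (n choose m)"

definition jack_q :: "nat \<Rightarrow> nat \<Rightarrow> kernel \<Rightarrow> (nat \<Rightarrow> nat \<Rightarrow> real) \<Rightarrow> nat \<Rightarrow> real" where
  "jack_q n m \<phi> x a =
    (\<Sum>l\<in>increasing_tuples (m - 1) ({1..n} - {a}).
        \<phi> (\<lambda>k\<in>{1..m}. if k = 1 then x a else x (l (k - 1))))
      / real ((n - 1) choose (m - 1))"

definition jack_var :: "nat \<Rightarrow> nat \<Rightarrow> kernel \<Rightarrow> (nat \<Rightarrow> nat \<Rightarrow> real) \<Rightarrow> real" where
  "jack_var n m \<phi> x =
    (real m)\<^sup>2 * (real n - 1) / (real n * (real n - real m)\<^sup>2)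
      * (\<Sum>a\<in>{1..n}. (jack_q n m \<phi> x a - ustat n m \<phi> x)\<^sup>2)"

definition max_stat ::
    "nat \<Rightarrow> nat \<Rightarrow> nat \<Rightarrow> nat \<Rightarrow> (nat \<Rightarrow> nat \<Rightarrow> kernel)
      \<Rightarrow> (nat \<Rightarrow> nat \<Rightarrow> real) \<Rightarrow> (nat \<Rightarrow> nat \<Rightarrow> real) \<Rightarrow> real" where
  "max_stat n1 n2 m q \<Phi> x y =
    Max ((\<lambda>(i, j). (ustat n1 m (\<Phi> i j) x - ustat n2 m (\<Phi> i j) y)\<^sup>2
                   / (jack_var n1 m (\<Phi> i j) x + jack_var n2 m (\<Phi> i j) y))
         ` ({1..q} \<times> {1..q}))"

definition gumbel_quantile :: "real \<Rightarrow> real" where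
  "gumbel_quantile \<alpha> = - ln (8 * pi) - 2 * ln (- ln (1 - \<alpha>))"

definition max_test ::
    "real \<Rightarrow> nat \<Rightarrow> nat \<Rightarrow> nat \<Rightarrow> nat \<Rightarrow> (nat \<Rightarrow> nat \<Rightarrow> kernel)
      \<Rightarrow> (nat \<Rightarrow> nat \<Rightarrow> real) \<Rightarrow> (nat \<Rightarrow> nat \<Rightarrow> real) \<Rightarrow> real" where
  "max_test \<alpha> n1 n2 m q \<Phi> x y =
    (if max_stat n1 n2 m q \<Phi> x y \<ge> gumbel_quantile \<alpha> + 4 * ln (real q) - ln (ln (real q))
     then 1 else 0)"

text \<open>
  The samples are realised on the canonical space: \<open>iid \<mu> n\<close> is the joint law of \<open>n\<close> independent
  copies of a random vector with law \<open>\<mu>\<close>, and the two samples are coupled by the product measure.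
\<close>

definition iid :: "(nat \<Rightarrow> real) measure \<Rightarrow> nat \<Rightarrow> (nat \<Rightarrow> nat \<Rightarrow> real) measure" where
  "iid \<mu> n = (\<Pi>\<^sub>M l\<in>{1..n}. \<mu>)"

definition rejection_prob ::
    "real \<Rightarrow> nat \<Rightarrow> nat \<Rightarrow> nat \<Rightarrow> nat \<Rightarrow> (nat \<Rightarrow> nat \<Rightarrow> kernel)
      \<Rightarrow> (nat \<Rightarrow> real) measure \<Rightarrow> (nat \<Rightarrow> real) measure \<Rightarrow> real" where
  "rejection_prob \<alpha> n1 n2 m q \<Phi> \<mu> \<nu> =
    \<P>((x, y) in iid \<mu> n1 \<Otimes>\<^sub>M iid \<nu> n2. max_test \<alpha> n1 n2 m q \<Phi> x y = 1)"

definition ustat_mean :: "(nat \<Rightarrow> real) measure \<Rightarrow> nat \<Rightarrow> nat \<Rightarrow> kernel \<Rightarrow> real" where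
  "ustat_mean \<mu> n m \<phi> = (\<integral>x. ustat n m \<phi> x \<partial>iid \<mu> n)"

text \<open>
  The first-order projection is the conditional expectation of $\phi(X_1, \ldots, X_m)$ given the
  sigma-algebra generated by $X_1$, taken on the space of \<open>m\<close> independent copies. As the copies are
  i.i.d. and the kernel is symmetric, its law is the same for any other choice of distinct indices.
\<close>

definition projection ::
    "(nat \<Rightarrow> real) measure \<Rightarrow> nat \<Rightarrow> kernel \<Rightarrow> (nat \<Rightarrow> nat \<Rightarrow> real) \<Rightarrow> real" where
  "projection \<mu> m \<phi> =
    real_cond_exp (iid \<mu> m) (vimage_algebra (space (iid \<mu> m)) (\<lambda>x. x 1) \<mu>) \<phi>"

definition zeta :: "(nat \<Rightarrow> real) measure \<Rightarrow> nat \<Rightarrow> kernel \<Rightarrow> real" where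
  "zeta \<mu> m \<phi> = prob_space.variance (iid \<mu> m) (projection \<mu> m \<phi>)"

text \<open>
  The signal class consists of pairs of mean matrices (indexed by \<open>{1..q}\<close> in both arguments); the
  projection variances \<open>z1\<close>, \<open>z2\<close> of the two populations enter as parameters.
\<close>

definition signal_class ::
    "nat \<Rightarrow> nat \<Rightarrow> nat \<Rightarrow> nat \<Rightarrow> (nat \<Rightarrow> nat \<Rightarrow> real) \<Rightarrow> (nat \<Rightarrow> nat \<Rightarrow> real) \<Rightarrow> real
      \<Rightarrow> ((nat \<Rightarrow> nat \<Rightarrow> real) \<times> (nat \<Rightarrow> nat \<Rightarrow> real)) set" where
  "signal_class n1 n2 m q z1 z2 C =
    {(U1, U2).
      Max ((\<lambda>(i, j). \<bar>U1 i j - U2 i j\<bar>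
                     / sqrt ((real m)\<^sup>2 * z1 i j / real n1 + (real m)\<^sup>2 * z2 i j / real n2))
           ` ({1..q} \<times> {1..q}))
      \<ge> C * sqrt (ln (real q))}"

definition alternatives ::
    "nat \<Rightarrow> nat \<Rightarrow> nat \<Rightarrow> nat \<Rightarrow> nat \<Rightarrow> (nat \<Rightarrow> nat \<Rightarrow> kernel) \<Rightarrow> real \<Rightarrow> real \<Rightarrow> real
      \<Rightarrow> ((nat \<Rightarrow> real) measure \<times> (nat \<Rightarrow> real) measure) set" where
  "alternatives n1 n2 d m q \<Phi> r1 r2 C =
    {(\<mu>, \<nu>).
      distribution_on d \<mu> \<and> distribution_on d \<nu> \<and>
      (\<forall>i\<in>{1..q}. \<forall>j\<in>{1..q}. zeta \<mu> m (\<Phi> i j) > r1 \<and> zeta \<nu> m (\<Phi> i j) > r2) \<and>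
      ((\<lambda>i j. ustat_mean \<mu> n1 m (\<Phi> i j)), (\<lambda>i j. ustat_mean \<nu> n2 m (\<Phi> i j)))
        \<in> signal_class n1 n2 m q
             (\<lambda>i j. zeta \<mu> m (\<Phi> i j)) (\<lambda>i j. zeta \<nu> m (\<Phi> i j)) C}"

text \<open>
  The infimum of a family of probabilities is taken in the unit interval, so that the infimum of an
  empty family is \<open>1\<close> (the infimum of the empty set is not meaningful in type \<open>real\<close>). For a
  nonempty family of probabilities, inserting \<open>1\<close> changes nothing.
\<close>

definition unit_Inf :: "real set \<Rightarrow> real" where
  "unit_Inf S = Inf (insert 1 S)"

end

theory Submission
  imports Defs "HOL-Real_Asymp.Real_Asymp"
begin

text \<open>
  A single pair of indices attaining the maximal signal suffices for rejection, so no maximal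
  inequality is needed. For a fixed pair, a statistic of independent observations that moves by
  O(1/n) when one observation is replaced has variance O(1/n) (Efron--Stein). This applies to the
  U-statistic, to the jackknife components with their own observation held fixed (which gives
  their second moments up to O(1/n)), and to the average squared deviation of these components
  from the true mean. Chebyshev's inequality then makes the jackknife variance at most 3/2 of the
  target variance and the estimation error at most a quarter of the signal, with failure
  probability O(1/log q + 1/n) uniformly over the alternatives; on that event the studentised
  square is at least 6 log q, which beats the critical value 4 log q - log log q + O(1).
\<close>

text \<open>The obstacle is that the jackknife components share observations, so their average
  square is not an average of independent terms. Replacing one observation may change its own
  component by O(1), but that component has weight 1/n, and each of the others moves only by O(1/n);
  hence the average still has bounded differences of order 1/n.

  The projection variance enters through conditioning: with its own observation fixed at
  \<open>z\<close>, a component has mean exactly \<open>proj z\<close>, and its conditional variance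
  is O(1/n). Averaging over \<open>z\<close> leaves \<open>zeta\<close> plus O(1/n).

  Uniformity over the alternatives comes from comparing orders: the variance of the U-statistic is
  at most 4 B^2 m^2 / n, the target variance m^2 zeta / n exceeds m^2 r / n, and so their ratio is
  bounded by a constant free of the laws, the kernels and the index pair. A deviation of sqrt(log q)
  / 2 target standard deviations therefore has probability O(1 / log q) by Chebyshev.\<close>

section \<open>Variance bounds for bounded functions of independent observations\<close>

lemma (in prob_space) integrable_bounded:
  fixes f :: "'a \<Rightarrow> real"
  assumes "f \<in> borel_measurable M" "\<And>x. x \<in> space M \<Longrightarrow> \<bar>f x\<bar> \<le> b"
  shows "integrable M f"
  using assms by (intro integrable_const_bound[where B = b]) (auto intro!: AE_I2)

lemma (in prob_space) integrable_square_bounded: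
  fixes f :: "'a \<Rightarrow> real"
  assumes "f \<in> borel_measurable M" "\<And>x. x \<in> space M \<Longrightarrow> \<bar>f x\<bar> \<le> b"
  shows "integrable M (\<lambda>x. (f x)\<^sup>2)"
  using assms(1) power_mono[OF assms(2) abs_ge_zero, of _ 2]
  by (intro integrable_bounded[where b = "b\<^sup>2"]) auto

text \<open>Bias-variance decomposition; it later separates the conditional variance of a jackknife
  component from the squared deviation of \<open>proj\<close>.\<close>

lemma (in prob_space) second_moment_about:
  fixes f :: "'a \<Rightarrow> real"
  assumes "f \<in> borel_measurable M" "\<And>x. x \<in> space M \<Longrightarrow> \<bar>f x\<bar> \<le> b"
  shows "(\<integral>x. (f x - u)\<^sup>2 \<partial>M) = variance f + (expectation f - u)\<^sup>2"
proof -
  have "integrable M f" "integrable M (\<lambda>x. (f x)\<^sup>2)"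
    using integrable_bounded integrable_square_bounded assms by blast+
  then show ?thesis
    by (simp add: variance_eq power2_diff prob_space power2_eq_square algebra_simps)
qed

lemma (in prob_space) abs_expectation_le:
  fixes f :: "'a \<Rightarrow> real"
  assumes "f \<in> borel_measurable M" "\<And>x. x \<in> space M \<Longrightarrow> \<bar>f x\<bar> \<le> b"
  shows "\<bar>expectation f\<bar> \<le> b"
proof -
  have int: "integrable M f" using assms by (rule integrable_bounded)
  have "expectation f \<le> b" "- b \<le> expectation f"
    using assms(2) by (auto intro!: integral_le_const integral_ge_const int AE_I2
        simp: abs_le_iff minus_le_iff)
  then show ?thesis by linarith
qed

text \<open>The expectation is an average of values of \<open>f\<close>, so every value is within
  \<open>c\<close> of it. The optimal variance bound would be c^2 / 4; only the order matters
  later.\<close>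

lemma (in prob_space) second_moment_le_of_oscillation:
  fixes f :: "'a \<Rightarrow> real"
  assumes f[measurable]: "f \<in> borel_measurable M"
    and bound: "\<And>x. x \<in> space M \<Longrightarrow> \<bar>f x\<bar> \<le> b"
    and osc: "\<And>x y. x \<in> space M \<Longrightarrow> y \<in> space M \<Longrightarrow> \<bar>f x - f y\<bar> \<le> c"
  shows "(\<integral>x. (f x)\<^sup>2 \<partial>M) \<le> (\<integral>x. f x \<partial>M)\<^sup>2 + c\<^sup>2"
proof -
  have int: "integrable M f" and int2: "integrable M (\<lambda>x. (f x)\<^sup>2)"
    using integrable_bounded integrable_square_bounded f bound by blast+
  have near: "\<bar>f x - expectation f\<bar> \<le> c" if x: "x \<in> space M" for x
  proof -
    have "expectation f \<le> f x + c"
      using osc[OF _ x] by (intro integral_le_const int AE_I2) (smt (verit))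
    moreover have "f x - c \<le> expectation f"
      using osc[OF _ x] by (intro integral_ge_const int AE_I2) (smt (verit))
    ultimately show ?thesis by linarith
  qed
  have "expectation (\<lambda>x. (f x - expectation f)\<^sup>2) \<le> c\<^sup>2"
  proof (rule integral_le_const)
    show "integrable M (\<lambda>x. (f x - expectation f)\<^sup>2)"
      using int int2 by (simp add: power2_diff)
    show "AE x in M. (f x - expectation f)\<^sup>2 \<le> c\<^sup>2"
      using near by (intro AE_I2) (metis abs_le_square_iff abs_of_nonneg abs_ge_zero order_trans)
  qed
  then show ?thesis
    using variance_eq[OF int int2] by simp
qed

text \<open>One coordinate is averaged out at a time. Its oscillation costs at most c^2 in the
  second moment, and the averaged function inherits the bounded differences in the remaining
  coordinates.\<close>

lemma efron_stein_bounded_differences: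
  fixes M :: "'i \<Rightarrow> 'a measure" and f :: "('i \<Rightarrow> 'a) \<Rightarrow> real" and b c :: real
  assumes M: "\<And>i. prob_space (M i)" and "finite I"
    and "f \<in> borel_measurable (Pi\<^sub>M I M)"
    and "\<And>x. x \<in> space (Pi\<^sub>M I M) \<Longrightarrow> \<bar>f x\<bar> \<le> b"
    and "\<And>x i z. x \<in> space (Pi\<^sub>M I M) \<Longrightarrow> i \<in> I \<Longrightarrow> z \<in> space (M i)
           \<Longrightarrow> \<bar>f (x(i := z)) - f x\<bar> \<le> c"
  shows "prob_space.variance (Pi\<^sub>M I M) f \<le> card I * c\<^sup>2"
proof -
  interpret product_prob_space M I
    by (simp add: product_prob_space_def product_prob_space_axioms_def product_sigma_finite_def
        M prob_space_imp_sigma_finite)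
  \<comment> \<open>Second moments suit the induction better than variances: averaging out a
    coordinate preserves the mean, so the squared mean passes through unchanged.\<close>
  have "(\<integral>x. (f x)\<^sup>2 \<partial>Pi\<^sub>M I M) \<le> (\<integral>x. f x \<partial>Pi\<^sub>M I M)\<^sup>2 + card I * c\<^sup>2"
    using assms(2-)
  proof (induction I arbitrary: f rule: finite_induct)
    case empty
    then show ?case by (simp add: PiM_empty lebesgue_integral_count_space_finite)
  next
    case (insert i J)
    note [measurable] = insert.prems(1)
    interpret J: product_prob_space M J by unfold_locales
    interpret iJ: product_prob_space M "insert i J" by unfold_locales
    define h where "h y = (\<integral>z. f (y(i := z)) \<partial>M i)" for y
    have upd: "y(i := z) \<in> space (Pi\<^sub>M (insert i J) M)"
      if "y \<in> space (Pi\<^sub>M J M)" "z \<in> space (M i)" for y z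
      using that by (auto simp: space_PiM PiE_iff extensional_def)
    have bound_upd: "\<bar>f (y(i := z))\<bar> \<le> b"
      if "y \<in> space (Pi\<^sub>M J M)" "z \<in> space (M i)" for y z
      by (rule insert.prems(2)[OF upd[OF that]])
    have slice: "(\<lambda>z. f (y(i := z))) \<in> borel_measurable (M i)" if "y \<in> space (Pi\<^sub>M J M)" for y
      using measurable_comp[OF measurable_component_update[OF that insert.hyps(2)] insert.prems(1)]
      by (simp add: comp_def)
    have slice_int: "integrable (M i) (\<lambda>z. f (y(i := z)))" if "y \<in> space (Pi\<^sub>M J M)" for y
      using slice[OF that] bound_upd[OF that] by (rule M.integrable_bounded)
    have int: "integrable (Pi\<^sub>M (insert i J) M) f"
      and int2: "integrable (Pi\<^sub>M (insert i J) M) (\<lambda>x. (f x)\<^sup>2)"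
      using iJ.P.integrable_bounded iJ.P.integrable_square_bounded insert.prems(1,2) by blast+
    have meas_upd: "(\<lambda>(y, z). g (y(i := z))) \<in> borel_measurable (Pi\<^sub>M J M \<Otimes>\<^sub>M M i)"
      if "g \<in> borel_measurable (Pi\<^sub>M (insert i J) M)" for g :: "_ \<Rightarrow> real"
      using measurable_comp[OF measurable_add_dim that] by (simp add: comp_def case_prod_unfold)
    have meas_h[measurable]: "h \<in> borel_measurable (Pi\<^sub>M J M)"
      unfolding h_def using meas_upd[OF insert.prems(1)]
      by (intro M.borel_measurable_lebesgue_integral) auto
    have meas_sq: "(\<lambda>y. \<integral>z. (f (y(i := z)))\<^sup>2 \<partial>M i) \<in> borel_measurable (Pi\<^sub>M J M)"
      using meas_upd[of "\<lambda>x. (f x)\<^sup>2"]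
      by (intro M.borel_measurable_lebesgue_integral) auto
    have bound_h: "\<bar>h y\<bar> \<le> b" if y: "y \<in> space (Pi\<^sub>M J M)" for y
      unfolding h_def using slice[OF y] bound_upd[OF y] by (rule M.abs_expectation_le)
    have h_diff: "\<bar>h (y(j := w)) - h y\<bar> \<le> c"
      if y: "y \<in> space (Pi\<^sub>M J M)" and j: "j \<in> J" and w: "w \<in> space (M j)" for y j w
    proof -
      have y': "y(j := w) \<in> space (Pi\<^sub>M J M)"
        using y j w by (auto simp: space_PiM PiE_iff extensional_def)
      have le: "\<bar>f ((y(j := w))(i := z)) - f (y(i := z))\<bar> \<le> c" if z: "z \<in> space (M i)" for z
      proof -
        have "(y(j := w))(i := z) = (y(i := z))(j := w)"
          using j insert.hyps by (metis fun_upd_twist)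
        then show ?thesis using insert.prems(3)[OF upd[OF y z] insertI2[OF j] w] by (simp only:)
      qed
      have "h (y(j := w)) - h y = (\<integral>z. f ((y(j := w))(i := z)) - f (y(i := z)) \<partial>M i)"
        unfolding h_def using slice_int[OF y] slice_int[OF y'] by simp
      also have "\<bar>\<dots>\<bar> \<le> c"
        using slice[OF y] slice[OF y'] le by (intro M.abs_expectation_le) auto
      finally show ?thesis .
    qed
    have slice_sq: "(\<integral>z. (f (y(i := z)))\<^sup>2 \<partial>M i) \<le> (h y)\<^sup>2 + c\<^sup>2"
      if y: "y \<in> space (Pi\<^sub>M J M)" for y
      unfolding h_def
    proof (rule M.second_moment_le_of_oscillation[OF slice[OF y], where b = b])
      fix z w assume z: "z \<in> space (M i)" and w: "w \<in> space (M i)"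
      show "\<bar>f (y(i := z))\<bar> \<le> b" by (rule insert.prems(2)[OF upd[OF y z]])
      show "\<bar>f (y(i := z)) - f (y(i := w))\<bar> \<le> c"
        using insert.prems(3)[OF upd[OF y w] insertI1 z] by (simp only: fun_upd_upd)
    qed
    have h_int2: "integrable (Pi\<^sub>M J M) (\<lambda>y. (h y)\<^sup>2)"
      using J.P.integrable_square_bounded meas_h bound_h by blast
    have "(\<integral>x. (f x)\<^sup>2 \<partial>Pi\<^sub>M (insert i J) M)
        = (\<integral>y. (\<integral>z. (f (y(i := z)))\<^sup>2 \<partial>M i) \<partial>Pi\<^sub>M J M)"
      by (rule product_integral_insert[OF insert.hyps int2])
    also have "\<dots> \<le> (\<integral>y. (h y)\<^sup>2 + c\<^sup>2 \<partial>Pi\<^sub>M J M)"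
    proof (rule integral_mono)
      show "integrable (Pi\<^sub>M J M) (\<lambda>y. \<integral>z. (f (y(i := z)))\<^sup>2 \<partial>M i)"
        by (rule Bochner_Integration.integrable_bound[OF Bochner_Integration.integrable_add
              [OF h_int2 J.integrable_const[of "c\<^sup>2"]] meas_sq])
          (auto intro!: AE_I2 slice_sq)
    qed (use h_int2 slice_sq in auto)
    also have "\<dots> = (\<integral>y. (h y)\<^sup>2 \<partial>Pi\<^sub>M J M) + c\<^sup>2"
      using h_int2 by (simp add: J.P.prob_space)
    also have "\<dots> \<le> (\<integral>y. h y \<partial>Pi\<^sub>M J M)\<^sup>2 + card J * c\<^sup>2 + c\<^sup>2"
      using insert.IH[OF meas_h bound_h h_diff] by simp
    also have "(\<integral>y. h y \<partial>Pi\<^sub>M J M) = (\<integral>x. f x \<partial>Pi\<^sub>M (insert i J) M)"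
      unfolding h_def by (rule product_integral_insert[OF insert.hyps int, symmetric])
    finally show ?case using insert.hyps by (simp add: algebra_simps)
  qed
  moreover have "integrable (Pi\<^sub>M I M) f" "integrable (Pi\<^sub>M I M) (\<lambda>x. (f x)\<^sup>2)"
    using P.integrable_bounded P.integrable_square_bounded assms(3,4) by blast+
  ultimately show ?thesis
    by (simp add: P.variance_eq)
qed

section \<open>Counting increasing tuples and averaging over them\<close>

text \<open>A finite set of naturals has exactly one increasing enumeration; this reduces the
  counting of tuples to binomial coefficients.\<close>

lemma bij_betw_increasing_tuples:
  assumes "finite A"
  shows "bij_betw (\<lambda>l. l ` {1..r}) (increasing_tuples r A) {S. S \<subseteq> A \<and> card S = r}"
  unfolding bij_betw_def
proof
  show "inj_on (\<lambda>l. l ` {1..r}) (increasing_tuples r A)"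
  proof (rule inj_onI)
    fix l l' assume l: "l \<in> increasing_tuples r A" and l': "l' \<in> increasing_tuples r A"
      and eq: "l ` {1..r} = l' ` {1..r}"
    have "l k = l' k" if "k \<in> {1..r}" for k
      using that
    proof (induction k rule: less_induct)
      case (less k)
      \<comment> \<open>At the first index of disagreement, the smaller value \<open>f k\<close>
        must be some \<open>g j\<close> with j < k. There \<open>f\<close> and \<open>g\<close>
        agree, so f j = f k, against strict monotonicity. Generic \<open>f\<close> and
        \<open>g\<close> allow both orders of \<open>l\<close> and \<open>l'\<close>.\<close>
      have key: "\<not> f k < g k" if fg: "f \<in> increasing_tuples r A" "g \<in> increasing_tuples r A"
        "f ` {1..r} = g ` {1..r}" "\<And>j. j < k \<Longrightarrow> j \<in> {1..r} \<Longrightarrow> f j = g j" for f g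
      proof
        assume lt: "f k < g k"
        obtain j where j: "j \<in> {1..r}" "f k = g j" using fg(3) less.prems by blast
        have sm: "strict_mono_on {1..r} f" "strict_mono_on {1..r} g"
          using fg by (auto simp: increasing_tuples_def)
        have "j < k" using lt j strict_mono_on_leD[OF sm(2) less.prems j(1)] by force
        then show False
          using fg(4)[OF _ j(1)] j strict_mono_onD[OF sm(1) j(1) less.prems] by simp
      qed
      show ?case
        using key[OF l l' eq] key[OF l' l eq[symmetric]] less.IH by (metis linorder_neqE_nat)
    qed
    then show "l = l'"
      using l l' by (intro PiE_ext[of l "{1..r}" "\<lambda>_. A" l']) (auto simp: increasing_tuples_def)
  qed
  show "(\<lambda>l. l ` {1..r}) ` increasing_tuples r A = {S. S \<subseteq> A \<and> card S = r}"
  proof (intro equalityI subsetI)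
    fix S assume "S \<in> (\<lambda>l. l ` {1..r}) ` increasing_tuples r A"
    then obtain l where l: "l \<in> increasing_tuples r A" "S = l ` {1..r}" by auto
    then have "inj_on l {1..r}"
      by (auto simp: increasing_tuples_def intro: strict_mono_on_imp_inj_on)
    with l show "S \<in> {S. S \<subseteq> A \<and> card S = r}"
      by (auto simp: card_image increasing_tuples_def)
  next
    fix S assume "S \<in> {S. S \<subseteq> A \<and> card S = r}"
    then have S: "S \<subseteq> A" "card S = r" "finite S"
      using assms finite_subset by auto
    obtain h where h: "bij_betw h {..<r} S" "strict_mono_on {..<r} h"
      using ex_bij_betw_strict_mono_card[OF S(3)] S(2) by metis
    \<comment> \<open>\<open>h\<close> enumerates from index 0, tuples from index 1.\<close>
    define l where "l = (\<lambda>k\<in>{1..r}. h (k - 1))"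
    have shift: "(\<lambda>k. k - 1) ` {1..r} = {..<r}"
    proof (intro equalityI subsetI)
      fix k assume "k \<in> {..<r}"
      then have "Suc k \<in> {1..r}" "k = Suc k - 1" by auto
      then show "k \<in> (\<lambda>k. k - 1) ` {1..r}" by blast
    qed auto
    have im: "l ` {1..r} = S"
    proof -
      have "l ` {1..r} = h ` ((\<lambda>k. k - 1) ` {1..r})" by (auto simp: l_def image_image)
      also have "\<dots> = S" unfolding shift using h(1) by (simp add: bij_betw_def)
      finally show ?thesis .
    qed
    moreover have "strict_mono_on {1..r} l"
      by (intro strict_mono_onI) (auto simp: l_def intro!: strict_mono_onD[OF h(2)])
    ultimately have "l \<in> increasing_tuples r A"
      using S(1) by (auto simp: increasing_tuples_def l_def)
    with im show "S \<in> (\<lambda>l. l ` {1..r}) ` increasing_tuples r A" by blast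
  qed
qed

lemma card_increasing_tuples:
  "finite A \<Longrightarrow> card (increasing_tuples r A) = card A choose r"
  using bij_betw_same_card[OF bij_betw_increasing_tuples] by (simp add: n_subsets)

lemma finite_increasing_tuples: "finite A \<Longrightarrow> finite (increasing_tuples r A)"
  unfolding increasing_tuples_def by (rule finite_subset[OF _ finite_PiE[of "{1..r}" "\<lambda>_. A"]]) auto

text \<open>Tuples avoiding \<open>i\<close> are the tuples over \<open>A - {i}\<close>, so Pascal's
  rule counts the others, and the absorption identity gives the proportion r / |A|. The form without
  division also covers a vanishing binomial coefficient.\<close>

lemma card_increasing_tuples_containing:
  assumes "finite A" "i \<in> A"
  shows "real (card {l \<in> increasing_tuples r A. i \<in> l ` {1..r}}) * card A
    = r * real (card A choose r)"
proof -
  have "{l \<in> increasing_tuples r A. i \<in> l ` {1..r}}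
      = increasing_tuples r A - increasing_tuples r (A - {i})"
    by (auto simp: increasing_tuples_def PiE_iff)
  moreover have "increasing_tuples r (A - {i}) \<subseteq> increasing_tuples r A"
    by (auto simp: increasing_tuples_def)
  ultimately have "card {l \<in> increasing_tuples r A. i \<in> l ` {1..r}}
      = (card A choose r) - (card A - 1 choose r)"
    using assms by (simp add: card_Diff_subset finite_increasing_tuples card_increasing_tuples)
  moreover obtain N where "card A = Suc N" using assms by (metis card_Suc_Diff1)
  ultimately show ?thesis
  proof (cases r)
    case (Suc r')
    have "(Suc N choose Suc r') - (N choose Suc r') = N choose r'" by simp
    then show ?thesis using \<open>card {l \<in> _. _} = _\<close> \<open>card A = Suc N\<close> Suc Suc_times_binomial[of r' N]
      by (metis diff_Suc_1 mult.commute of_nat_mult)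
  qed simp
qed

text \<open>Only tuples through \<open>i\<close> contribute, at most 2 B each, and they form a
  proportion r / |A| of all tuples. This is the source of every O(1/n) difference bound for
  U-statistics and jackknife components.\<close>

lemma tuple_average_diff_le:
  fixes F F' :: "(nat \<Rightarrow> nat) \<Rightarrow> real"
  assumes A: "finite A" "i \<in> A" and r: "r \<le> card A"
    and F: "\<And>l. l \<in> increasing_tuples r A \<Longrightarrow> \<bar>F l\<bar> \<le> B"
    and F': "\<And>l. l \<in> increasing_tuples r A \<Longrightarrow> \<bar>F' l\<bar> \<le> B"
    and eq: "\<And>l. l \<in> increasing_tuples r A \<Longrightarrow> i \<notin> l ` {1..r} \<Longrightarrow> F l = F' l"
  shows "\<bar>(\<Sum>l\<in>increasing_tuples r A. F l) / real (card A choose r)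
        - (\<Sum>l\<in>increasing_tuples r A. F' l) / real (card A choose r)\<bar> \<le> 2 * B * r / card A"
proof -
  let ?T = "increasing_tuples r A" and ?U = "{l \<in> increasing_tuples r A. i \<in> l ` {1..r}}"
  have pos: "0 < real (card A choose r)" "0 < real (card A)"
    using r A by (auto simp: card_gt_0_iff)
  have "\<bar>(\<Sum>l\<in>?T. F l) - (\<Sum>l\<in>?T. F' l)\<bar> = \<bar>\<Sum>l\<in>?T. F l - F' l\<bar>"
    by (simp add: sum_subtractf)
  also have "(\<Sum>l\<in>?T. F l - F' l) = (\<Sum>l\<in>?U. F l - F' l)"
    using A eq by (intro sum.mono_neutral_right) (auto simp: finite_increasing_tuples)
  also have "\<bar>\<dots>\<bar> \<le> (\<Sum>l\<in>?U. 2 * B)"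
    using F F' by (intro order_trans[OF sum_abs] sum_mono) (smt (verit) mem_Collect_eq)
  also have "\<dots> = 2 * B * (r * real (card A choose r) / card A)"
    using card_increasing_tuples_containing[OF A, of r] pos by (simp add: field_simps)
  finally show ?thesis
    using pos by (simp add: diff_divide_distrib[symmetric] field_simps)
qed

section \<open>Integration over product measures\<close>

text \<open>\<open>product_integral_insert\<close> places the coordinate \<open>i\<close> in the
  inner integral; Fubini moves it outside, as conditioning on that observation requires.\<close>

lemma (in product_prob_space) integral_insert_rev:
  fixes f :: "_ \<Rightarrow> real"
  assumes I: "finite J" "i \<notin> J"
    and f: "f \<in> borel_measurable (Pi\<^sub>M (insert i J) M)"
    and bound: "\<And>x. x \<in> space (Pi\<^sub>M (insert i J) M) \<Longrightarrow> \<bar>f x\<bar> \<le> b"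
  shows "integral\<^sup>L (Pi\<^sub>M (insert i J) M) f = (\<integral>z. (\<integral>x. f (x(i := z)) \<partial>Pi\<^sub>M J M) \<partial>M i)"
proof -
  interpret J: product_prob_space M J by unfold_locales
  interpret iJ: product_prob_space M "insert i J" by unfold_locales
  interpret pair: pair_prob_space "M i" "Pi\<^sub>M J M" by unfold_locales
  have meas: "(\<lambda>(z, x). f (x(i := z))) \<in> borel_measurable (M i \<Otimes>\<^sub>M Pi\<^sub>M J M)"
    using measurable_comp[OF measurable_pair_swap' measurable_comp[OF measurable_add_dim f]]
    by (simp add: comp_def case_prod_unfold)
  have int: "integrable (M i \<Otimes>\<^sub>M Pi\<^sub>M J M) (\<lambda>(z, x). f (x(i := z)))"
  proof (rule pair.integrable_bounded[OF meas])
    fix w assume "w \<in> space (M i \<Otimes>\<^sub>M Pi\<^sub>M J M)"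
    then have "(snd w)(i := fst w) \<in> space (Pi\<^sub>M (insert i J) M)"
      by (auto simp: space_pair_measure space_PiM PiE_iff extensional_def)
    from bound[OF this] show "\<bar>case w of (z, x) \<Rightarrow> f (x(i := z))\<bar> \<le> b"
      by (simp add: case_prod_unfold)
  qed
  have "integrable (Pi\<^sub>M (insert i J) M) f"
    using f bound by (rule iJ.P.integrable_bounded)
  from product_integral_insert[OF I this] show ?thesis
    using pair.Fubini_integral[OF int] by simp
qed

text \<open>Independent copies at distinct indices have the same joint law whatever the indices are;
  injectivity of \<open>l\<close> is what makes them distinct.\<close>

lemma integral_PiM_tuple:
  fixes F :: "_ \<Rightarrow> real"
  assumes "prob_space M" "inj_on l K" "l \<in> K \<rightarrow> A" "F \<in> borel_measurable (\<Pi>\<^sub>M k\<in>K. M)"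
  shows "(\<integral>x. F (\<lambda>k\<in>K. x (l k)) \<partial>(\<Pi>\<^sub>M k\<in>A. M)) = (\<integral>x. F x \<partial>(\<Pi>\<^sub>M k\<in>K. M))"
proof -
  have "(\<integral>x. F x \<partial>(\<Pi>\<^sub>M k\<in>K. M))
      = (\<integral>x. F x \<partial>distr (\<Pi>\<^sub>M k\<in>A. M) (\<Pi>\<^sub>M k\<in>K. M) (\<lambda>x. \<lambda>k\<in>K. x (l k)))"
    using distr_PiM_reindex[of A "\<lambda>_. M" l K] assms by simp
  also have "\<dots> = (\<integral>x. F (\<lambda>k\<in>K. x (l k)) \<partial>(\<Pi>\<^sub>M k\<in>A. M))"
    using assms by (intro integral_distr) (auto intro!: measurable_restrict measurable_component_singleton)
  finally show ?thesis ..
qed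

text \<open>If there are no tuples, the quotient is 0 / 0 = 0, and the bound rests on 0 \<le>
  B.\<close>

lemma abs_tuple_average_le:
  fixes F :: "(nat \<Rightarrow> nat) \<Rightarrow> real"
  assumes "finite A" "0 \<le> B" "\<And>l. l \<in> increasing_tuples r A \<Longrightarrow> \<bar>F l\<bar> \<le> B"
  shows "\<bar>(\<Sum>l\<in>increasing_tuples r A. F l) / real (card A choose r)\<bar> \<le> B"
proof -
  have "\<bar>\<Sum>l\<in>increasing_tuples r A. F l\<bar> \<le> (\<Sum>l\<in>increasing_tuples r A. B)"
    using assms by (intro order_trans[OF sum_abs] sum_mono)
  also have "\<dots> = real (card A choose r) * B"
    using assms by (simp add: card_increasing_tuples)
  finally show ?thesis
    using assms(2) by (cases "card A choose r = 0") (auto simp: field_simps)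
qed

lemma increasing_tuplesD:
  assumes "l \<in> increasing_tuples r A"
  shows "k \<in> {1..r} \<Longrightarrow> l k \<in> A" "inj_on l {1..r}"
  using assms by (auto simp: increasing_tuples_def intro: strict_mono_on_imp_inj_on)

section \<open>One population with one kernel: projection and U-statistic\<close>

locale bounded_kernel = prob_space \<mu> for \<mu> :: "(nat \<Rightarrow> real) measure" +
  fixes m :: nat and B :: real and \<phi> :: kernel
  assumes m: "1 \<le> m" and B: "0 < B"
    and kernel_measurable: "\<phi> \<in> borel_measurable (\<Pi>\<^sub>M l\<in>{1..m}. \<mu>)"
    and kernel_bound: "\<And>x. x \<in> space (\<Pi>\<^sub>M l\<in>{1..m}. \<mu>) \<Longrightarrow> \<bar>\<phi> x\<bar> \<le> B"
begin

abbreviation P :: "nat set \<Rightarrow> (nat \<Rightarrow> nat \<Rightarrow> real) measure" where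
  "P A \<equiv> \<Pi>\<^sub>M l\<in>A. \<mu>"

definition mean :: real where
  "mean = (\<integral>x. \<phi> x \<partial>P {1..m})"

text \<open>The explicit version of the conditional expectation in \<open>projection\<close>, as a
  function of a single vector. Slot 1 is the fixed one because \<open>jack_q\<close> puts its own
  observation there.\<close>

definition proj :: "(nat \<Rightarrow> real) \<Rightarrow> real" where
  "proj z = (\<integral>w. \<phi> (w(1 := z)) \<partial>P {2..m})"

lemma product_prob: "product_prob_space (\<lambda>_. \<mu>)"
  by (simp add: product_prob_space_def product_prob_space_axioms_def product_sigma_finite_def
      prob_space_axioms prob_space_imp_sigma_finite)

lemma prob_P: "prob_space (P A)"
  by (intro prob_space_PiM prob_space_axioms)

lemma insert_1: "insert (1::nat) {2..m} = {1..m}"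
  using m by auto

lemma upd_space: "w \<in> space (P A) \<Longrightarrow> z \<in> space \<mu> \<Longrightarrow> w(a := z) \<in> space (P (insert a A))"
  by (auto simp: space_PiM PiE_iff extensional_def)

lemma upd_space_same: "w \<in> space (P A) \<Longrightarrow> z \<in> space \<mu> \<Longrightarrow> a \<in> A \<Longrightarrow> w(a := z) \<in> space (P A)"
  using upd_space[of w A z a] by (simp add: insert_absorb)

lemma upd_measurable: "z \<in> space \<mu> \<Longrightarrow> (\<lambda>w. \<phi> (w(1 := z))) \<in> borel_measurable (P {2..m})"
proof -
  assume "z \<in> space \<mu>"
  then have "(\<lambda>w. w(1 := z)) \<in> measurable (P {2..m}) (P (insert 1 {2..m}))"
    using measurable_compose[OF measurable_Pair measurable_add_dim, of "\<lambda>w. w" "P {2..m}" "{2..m}"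
        "\<lambda>_. \<mu>" "\<lambda>_. z" 1] by simp
  from measurable_compose[OF this[unfolded insert_1] kernel_measurable] show ?thesis .
qed

lemma upd_bound: "z \<in> space \<mu> \<Longrightarrow> w \<in> space (P {2..m}) \<Longrightarrow> \<bar>\<phi> (w(1 := z))\<bar> \<le> B"
  using upd_space[of w "{2..m}" z 1, unfolded insert_1] by (intro kernel_bound)

lemma tuple_bound:
  "x \<in> space (P A) \<Longrightarrow> (\<And>k. k \<in> {1..m} \<Longrightarrow> l k \<in> A) \<Longrightarrow> \<bar>\<phi> (\<lambda>k\<in>{1..m}. x (l k))\<bar> \<le> B"
  by (intro kernel_bound) (auto simp: space_PiM PiE_iff)

lemma tuple_measurable:
  "(\<And>k. k \<in> {1..m} \<Longrightarrow> l k \<in> A) \<Longrightarrow> (\<lambda>x. \<phi> (\<lambda>k\<in>{1..m}. x (l k))) \<in> borel_measurable (P A)"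
  by (intro measurable_compose[OF measurable_restrict kernel_measurable]
      measurable_component_singleton) auto

lemma upd_pair_measurable:
  "(\<lambda>(z, x). x(a := z)) \<in> measurable (\<mu> \<Otimes>\<^sub>M P A) (P (insert a A))"
  using measurable_comp[OF measurable_pair_swap' measurable_add_dim]
  by (simp add: comp_def case_prod_unfold)

lemma proj_measurable: "proj \<in> borel_measurable \<mu>"
proof -
  interpret two: prob_space "P {2..m}" by (rule prob_P)
  from measurable_compose[OF upd_pair_measurable[of 1 "{2..m}", unfolded insert_1] kernel_measurable]
  show ?thesis unfolding proj_def
    by (intro two.borel_measurable_lebesgue_integral) (simp add: case_prod_unfold)
qed

lemma proj_bound: "z \<in> space \<mu> \<Longrightarrow> \<bar>proj z\<bar> \<le> B"
  unfolding proj_def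
  by (rule prob_space.abs_expectation_le[OF prob_P upd_measurable upd_bound])

lemma mean_bound: "\<bar>mean\<bar> \<le> B"
  unfolding mean_def
  by (rule prob_space.abs_expectation_le[OF prob_P kernel_measurable kernel_bound])

lemma expectation_proj: "(\<integral>z. proj z \<partial>\<mu>) = mean"
proof -
  interpret product_prob_space "\<lambda>_. \<mu>" "{1..m}" by (rule product_prob)
  show ?thesis
    unfolding mean_def proj_def
    using integral_insert_rev[of "{2..m}" 1 \<phi> B, unfolded insert_1] kernel_measurable kernel_bound
    by auto
qed

text \<open>Verified by the defining property of conditional expectation: the integrals over every
  event determined by the first coordinate agree, by Fubini.\<close>

lemma projection_eq: "AE x in P {1..m}. projection \<mu> m \<phi> x = proj (x 1)"
  unfolding projection_def iid_def
proof (rule sigma_finite_subalgebra.real_cond_exp_charact)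
  interpret product_prob_space "\<lambda>_. \<mu>" "{1..m}" by (rule product_prob)
  let ?F = "vimage_algebra (space (P {1..m})) (\<lambda>x. x 1) \<mu>"
  have one: "1 \<in> {1..m}" using m by simp
  have comp1: "(\<lambda>x. x 1) \<in> measurable (P {1..m}) \<mu>"
    using one by (rule measurable_component_singleton)
  have space1: "(\<lambda>x. x 1) \<in> space (P {1..m}) \<rightarrow> space \<mu>"
    using measurable_space[OF comp1] by auto
  show "sigma_finite_subalgebra (P {1..m}) ?F"
  proof (rule finite_measure_subalgebra_is_sigma_finite)
    show "finite_measure_subalgebra (P {1..m}) ?F"
      by (intro finite_measure_subalgebra.intro finite_measure_subalgebra_axioms.intro
          P.finite_measure_axioms) (use sets_image_in_sets[OF refl comp1] in \<open>simp add: subalgebra_def\<close>)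
  qed
  show "integrable (P {1..m}) \<phi>"
    using kernel_measurable kernel_bound by (rule P.integrable_bounded)
  have m1: "(\<lambda>x. proj (x 1)) \<in> borel_measurable (P {1..m})"
    by (rule measurable_compose[OF comp1 proj_measurable])
  show "integrable (P {1..m}) (\<lambda>x. proj (x 1))"
    using m1 proj_bound[OF measurable_space[OF comp1]] by (rule P.integrable_bounded)
  show "(\<lambda>x. proj (x 1)) \<in> borel_measurable ?F"
    by (rule measurable_compose[OF measurable_vimage_algebra1[OF space1] proj_measurable])
  fix A assume "A \<in> sets ?F"
  then obtain A' where A': "A' \<in> sets \<mu>" "A = (\<lambda>x. x 1) -` A' \<inter> space (P {1..m})"
    using sets_vimage_algebra2[OF space1] by auto
  then have A: "A \<in> sets (P {1..m})"
    using measurable_sets[OF comp1] by simp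
  have "(\<integral>x\<in>A. \<phi> x \<partial>P {1..m})
      = (\<integral>z. (\<integral>w. indicator A (w(1 := z)) *\<^sub>R \<phi> (w(1 := z)) \<partial>P {2..m}) \<partial>\<mu>)"
    unfolding set_lebesgue_integral_def
  proof (subst (1) insert_1[symmetric], rule integral_insert_rev)
    show "(\<lambda>x. indicat_real A x *\<^sub>R \<phi> x) \<in> borel_measurable (P (insert 1 {2..m}))"
      unfolding insert_1 using A kernel_measurable by simp
    show "\<bar>indicat_real A x *\<^sub>R \<phi> x\<bar> \<le> B" if "x \<in> space (P (insert 1 {2..m}))" for x
      using that[unfolded insert_1] kernel_bound[of x] B by (simp add: indicator_def)
  qed auto
  also have "\<dots> = (\<integral>z. indicator A' z *\<^sub>R proj z \<partial>\<mu>)"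
  proof (intro Bochner_Integration.integral_cong refl)
    fix z assume z: "z \<in> space \<mu>"
    \<comment> \<open>Membership in \<open>A\<close> depends on the first coordinate alone, so the
      indicator leaves the inner integral, and what remains is \<open>proj z\<close>.\<close>
    have "indicat_real A (w(1 := z)) = indicator A' z" if "w \<in> space (P {2..m})" for w
      using upd_space[OF that z, of 1, unfolded insert_1] A'(2) by (simp add: indicator_def)
    then have "(\<integral>w. indicator A (w(1 := z)) *\<^sub>R \<phi> (w(1 := z)) \<partial>P {2..m})
        = (\<integral>w. indicator A' z *\<^sub>R \<phi> (w(1 := z)) \<partial>P {2..m})"
      by (intro Bochner_Integration.integral_cong) auto
    then show "(\<integral>w. indicator A (w(1 := z)) *\<^sub>R \<phi> (w(1 := z)) \<partial>P {2..m})
        = indicator A' z *\<^sub>R proj z"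
      by (simp add: proj_def)
  qed
  also have "\<dots> = (\<integral>z. indicator A' z *\<^sub>R proj z \<partial>distr (P {1..m}) \<mu> (\<lambda>x. x 1))"
    by (simp only: distr_PiM_component[OF prob_space one])
  also have "\<dots> = (\<integral>x. indicator A' (x 1) *\<^sub>R proj (x 1) \<partial>P {1..m})"
    using A'(1) proj_measurable by (intro integral_distr comp1) auto
  also have "\<dots> = (\<integral>x\<in>A. proj (x 1) \<partial>P {1..m})"
    unfolding set_lebesgue_integral_def
    by (intro Bochner_Integration.integral_cong) (auto simp: A'(2) indicator_def)
  finally show "(\<integral>x\<in>A. \<phi> x \<partial>P {1..m}) = (\<integral>x\<in>A. proj (x 1) \<partial>P {1..m})" .
qed

lemma zeta_eq: "zeta \<mu> m \<phi> = (\<integral>z. (proj z - mean)\<^sup>2 \<partial>\<mu>)"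
proof -
  interpret Pm: prob_space "P {1..m}" by (rule prob_P)
  have one: "1 \<in> {1..m}" using m by simp
  have comp1[measurable]: "(\<lambda>x. x 1) \<in> measurable (P {1..m}) \<mu>"
    using one by (rule measurable_component_singleton)
  note [measurable] = proj_measurable
  have push: "(\<integral>x. h (x 1) \<partial>P {1..m}) = (\<integral>z. h z \<partial>\<mu>)" if "h \<in> borel_measurable \<mu>"
    for h :: "_ \<Rightarrow> real"
    using integral_distr[OF comp1 that] distr_PiM_component[of "{1..m}" "\<lambda>_. \<mu>" 1] one
      prob_space_axioms by simp
  have [measurable]: "projection \<mu> m \<phi> \<in> borel_measurable (P {1..m})"
    unfolding projection_def iid_def by measurable
  have "Pm.expectation (projection \<mu> m \<phi>) = Pm.expectation (\<lambda>x. proj (x 1))"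
    using projection_eq by (intro integral_cong_AE) measurable
  then have e: "Pm.expectation (projection \<mu> m \<phi>) = mean"
    using push[OF proj_measurable] expectation_proj by simp
  have "zeta \<mu> m \<phi> = (\<integral>x. (proj (x 1) - mean)\<^sup>2 \<partial>P {1..m})"
    unfolding zeta_def iid_def e using projection_eq
    by (intro integral_cong_AE) (measurable, auto elim: eventually_mono)
  also have "\<dots> = (\<integral>z. (proj z - mean)\<^sup>2 \<partial>\<mu>)"
    by (rule push) measurable
  finally show ?thesis .
qed

lemma ustat_measurable: "ustat n m \<phi> \<in> borel_measurable (P {1..n})"
  unfolding ustat_def
  by (intro borel_measurable_divide borel_measurable_sum tuple_measurable borel_measurable_const)
    (rule increasing_tuplesD)

lemma ustat_bound: "x \<in> space (P {1..n}) \<Longrightarrow> \<bar>ustat n m \<phi> x\<bar> \<le> B"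
  unfolding ustat_def
  using abs_tuple_average_le[of "{1..n}" B m "\<lambda>l. \<phi> (\<lambda>k\<in>{1..m}. x (l k))"] B
    tuple_bound[of x "{1..n}"] increasing_tuplesD(1) by (metis card_atLeastAtMost diff_Suc_1
      finite_atLeastAtMost less_eq_real_def)

text \<open>Every summand has expectation \<open>mean\<close>, since its indices are distinct. The
  condition m \<le> n keeps the binomial coefficient positive; otherwise the U-statistic would be 0
  / 0 = 0.\<close>

lemma ustat_mean_eq:
  assumes "m \<le> n"
  shows "ustat_mean \<mu> n m \<phi> = mean"
proof -
  interpret Pn: prob_space "P {1..n}" by (rule prob_P)
  have eq: "(\<integral>x. \<phi> (\<lambda>k\<in>{1..m}. x (l k)) \<partial>P {1..n}) = mean"
    if "l \<in> increasing_tuples m {1..n}" for l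
    unfolding mean_def using increasing_tuplesD[OF that]
    by (intro integral_PiM_tuple prob_space_axioms kernel_measurable) auto
  have int: "integrable (P {1..n}) (\<lambda>x. \<phi> (\<lambda>k\<in>{1..m}. x (l k)))"
    if "l \<in> increasing_tuples m {1..n}" for l
    by (rule Pn.integrable_bounded[OF tuple_measurable tuple_bound])
      (use increasing_tuplesD(1)[OF that] in blast)+
  have "ustat_mean \<mu> n m \<phi> = real (card (increasing_tuples m {1..n})) * mean / real (n choose m)"
    unfolding ustat_mean_def iid_def ustat_def by (simp add: Bochner_Integration.integral_sum int eq del: One_nat_def restrict_upd)
  also have "\<dots> = mean"
    using assms by (simp add: card_increasing_tuples)
  finally show ?thesis .
qed

lemma ustat_diff:
  assumes "m \<le> n" and x: "x \<in> space (P {1..n})" and i: "i \<in> {1..n}" and z: "z \<in> space \<mu>"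
  shows "\<bar>ustat n m \<phi> (x(i := z)) - ustat n m \<phi> x\<bar> \<le> 2 * B * m / n"
proof -
  note xz = upd_space_same[OF x z i]
  have "\<bar>(\<Sum>l\<in>increasing_tuples m {1..n}. \<phi> (\<lambda>k\<in>{1..m}. (x(i := z)) (l k))) / real (card {1..n} choose m)
      - (\<Sum>l\<in>increasing_tuples m {1..n}. \<phi> (\<lambda>k\<in>{1..m}. x (l k))) / real (card {1..n} choose m)\<bar>
      \<le> 2 * B * m / card {1..n}"
  proof (rule tuple_average_diff_le[OF _ i])
    fix l assume l: "l \<in> increasing_tuples m {1..n}"
    show "\<bar>\<phi> (\<lambda>k\<in>{1..m}. (x(i := z)) (l k))\<bar> \<le> B" "\<bar>\<phi> (\<lambda>k\<in>{1..m}. x (l k))\<bar> \<le> B"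
      using tuple_bound[OF xz, of l] tuple_bound[OF x, of l] increasing_tuplesD(1)[OF l] by auto
    assume "i \<notin> l ` {1..m}"
    then show "\<phi> (\<lambda>k\<in>{1..m}. (x(i := z)) (l k)) = \<phi> (\<lambda>k\<in>{1..m}. x (l k))"
      by (intro arg_cong[where f = \<phi>]) (auto simp: restrict_def fun_eq_iff)
  qed (use assms in auto)
  then show ?thesis by (simp add: ustat_def)
qed

lemma variance_ustat:
  assumes "m \<le> n"
  shows "prob_space.variance (P {1..n}) (ustat n m \<phi>) \<le> 4 * B\<^sup>2 * (real m)\<^sup>2 / n"
proof -
  have "0 < n" using assms m by simp
  have "prob_space.variance (P {1..n}) (ustat n m \<phi>) \<le> card {1..n} * (2 * B * m / n)\<^sup>2"
    using ustat_bound ustat_diff[OF assms]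
    by (intro efron_stein_bounded_differences[where b = B] prob_space_axioms ustat_measurable) auto
  also have "\<dots> = 4 * B\<^sup>2 * (real m)\<^sup>2 / n"
    using \<open>0 < n\<close> by (simp add: power2_eq_square)
  finally show ?thesis .
qed

section \<open>Jackknife components and their second moments\<close>

lemma shifted_tuple_in:
  "l \<in> increasing_tuples (m - 1) A \<Longrightarrow> k \<in> {2..m} \<Longrightarrow> l (k - 1) \<in> A"
  by (rule increasing_tuplesD(1)) auto

lemma jack_tuple_in:
  "a \<in> {1..n} \<Longrightarrow> l \<in> increasing_tuples (m - 1) ({1..n} - {a}) \<Longrightarrow> k \<in> {1..m}
    \<Longrightarrow> (if k = 1 then a else l (k - 1)) \<in> {1..n}"
  using shifted_tuple_in[of l "{1..n} - {a}" k] by auto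

text \<open>With the case split moved into the index, each summand reads \<open>x\<close> along an
  index tuple, which is the form that \<open>tuple_bound\<close> and \<open>tuple_measurable\<close>
  handle.\<close>

lemma jack_q_eq:
  "jack_q n m \<phi> x a = (\<Sum>l\<in>increasing_tuples (m - 1) ({1..n} - {a}).
      \<phi> (\<lambda>k\<in>{1..m}. x (if k = 1 then a else l (k - 1)))) / real ((n - 1) choose (m - 1))"
  unfolding jack_q_def
  by (intro arg_cong2[where f = "(/)"] sum.cong arg_cong[where f = \<phi>] refl) auto

lemma jack_q_measurable:
  "a \<in> {1..n} \<Longrightarrow> (\<lambda>x. jack_q n m \<phi> x a) \<in> borel_measurable (P {1..n})"
  unfolding jack_q_eq
  by (intro borel_measurable_divide borel_measurable_sum tuple_measurable borel_measurable_const
      jack_tuple_in)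

lemma jack_q_bound:
  assumes "x \<in> space (P {1..n})" "a \<in> {1..n}"
  shows "\<bar>jack_q n m \<phi> x a\<bar> \<le> B"
proof -
  have "card ({1..n} - {a}) = n - 1" using assms by simp
  moreover have "\<bar>(\<Sum>l\<in>increasing_tuples (m - 1) ({1..n} - {a}).
      \<phi> (\<lambda>k\<in>{1..m}. x (if k = 1 then a else l (k - 1)))) / real (card ({1..n} - {a}) choose (m - 1))\<bar> \<le> B"
    using B by (intro abs_tuple_average_le tuple_bound[OF assms(1) jack_tuple_in[OF assms(2)]]) auto
  ultimately show ?thesis unfolding jack_q_eq by (simp only:)
qed

text \<open>An observation other than the component's own can enter only through the m - 1 free
  slots, which range over n - 1 indices.\<close>

lemma jack_q_diff:
  assumes "m \<le> n" and x: "x \<in> space (P {1..n})" and a: "a \<in> {1..n}"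
    and i: "i \<in> {1..n}" "i \<noteq> a" and z: "z \<in> space \<mu>"
  shows "\<bar>jack_q n m \<phi> (x(i := z)) a - jack_q n m \<phi> x a\<bar> \<le> 2 * B * (real m - 1) / (real n - 1)"
proof -
  note xz = upd_space_same[OF x z i(1)]
  let ?A = "{1..n} - {a}" and ?l = "\<lambda>l k. if k = 1 then a else l (k - 1)"
  have card: "card ?A = n - 1" using a by simp
  have "\<bar>(\<Sum>l\<in>increasing_tuples (m - 1) ?A. \<phi> (\<lambda>k\<in>{1..m}. (x(i := z)) (?l l k))) / real (card ?A choose (m - 1))
      - (\<Sum>l\<in>increasing_tuples (m - 1) ?A. \<phi> (\<lambda>k\<in>{1..m}. x (?l l k))) / real (card ?A choose (m - 1))\<bar>
      \<le> 2 * B * (m - 1 :: nat) / card ?A"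
  proof (rule tuple_average_diff_le)
    fix l assume l: "l \<in> increasing_tuples (m - 1) ?A"
    show "\<bar>\<phi> (\<lambda>k\<in>{1..m}. (x(i := z)) (?l l k))\<bar> \<le> B" "\<bar>\<phi> (\<lambda>k\<in>{1..m}. x (?l l k))\<bar> \<le> B"
      by (rule tuple_bound[OF xz jack_tuple_in[OF a l]] tuple_bound[OF x jack_tuple_in[OF a l]]; assumption)+
    assume "i \<notin> l ` {1..m - 1}"
    then have "?l l k \<noteq> i" if "k \<in> {1..m}" for k
      using that i(2) by (cases "k = 1") (auto intro!: image_eqI[where x = "k - 1"])
    then show "\<phi> (\<lambda>k\<in>{1..m}. (x(i := z)) (?l l k)) = \<phi> (\<lambda>k\<in>{1..m}. x (?l l k))"
      by (intro arg_cong[where f = \<phi>] restrict_ext fun_upd_other)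
  qed (use assms card in auto)
  then show ?thesis using m assms(1) unfolding jack_q_eq card by (simp add: of_nat_diff)
qed

text \<open>The index \<open>a\<close> never occurs in \<open>l\<close>, so \<open>z\<close> is read
  in slot 1 only. The kernel argument takes the shape \<open>w(1 := z)\<close> from the definition
  of \<open>proj\<close>.\<close>

lemma jack_q_slice:
  assumes a: "a \<in> {1..n}"
  shows "jack_q n m \<phi> (x(a := z)) a
    = (\<Sum>l\<in>increasing_tuples (m - 1) ({1..n} - {a}).
        \<phi> ((\<lambda>k\<in>{2..m}. x (l (k - 1)))(1 := z))) / real ((n - 1) choose (m - 1))"
proof -
  have "(\<lambda>k\<in>{1..m}. (x(a := z)) (if k = 1 then a else l (k - 1)))
      = (\<lambda>k\<in>{2..m}. x (l (k - 1)))(1 := z)"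
    if l: "l \<in> increasing_tuples (m - 1) ({1..n} - {a})" for l
  proof
    fix k
    consider "k = 1" | "k \<in> {2..m}" | "k \<notin> {1..m}" by force
    then show "(\<lambda>k\<in>{1..m}. (x(a := z)) (if k = 1 then a else l (k - 1))) k
      = ((\<lambda>k\<in>{2..m}. x (l (k - 1)))(1 := z)) k"
    proof cases
      case 2
      then have "l (k - 1) \<noteq> a" using shifted_tuple_in[OF l] by blast
      then show ?thesis using 2 by auto
    qed (use m in auto)
  qed
  then show ?thesis unfolding jack_q_eq by simp
qed

lemma expectation_jack_q_slice:
  assumes "m \<le> n" and a: "a \<in> {1..n}" and z: "z \<in> space \<mu>"
  shows "(\<integral>x. jack_q n m \<phi> (x(a := z)) a \<partial>P ({1..n} - {a})) = proj z"
proof -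
  let ?A = "{1..n} - {a}"
  interpret PA: prob_space "P ?A" by (rule prob_P)
  have card: "card ?A = n - 1" using a by simp
  have F: "(\<lambda>w. \<phi> (w(1 := z))) \<in> borel_measurable (P {2..m})"
    using z by (rule upd_measurable)
  have eq: "(\<integral>x. \<phi> ((\<lambda>k\<in>{2..m}. x (l (k - 1)))(1 := z)) \<partial>P ?A) = proj z"
    and int: "integrable (P ?A) (\<lambda>x. \<phi> ((\<lambda>k\<in>{2..m}. x (l (k - 1)))(1 := z)))"
    if l: "l \<in> increasing_tuples (m - 1) ?A" for l
  proof -
    have "inj_on (\<lambda>k. l (k - 1)) {2..m}"
      by (intro inj_onI) (use increasing_tuplesD(2)[OF l] in \<open>fastforce dest: inj_onD\<close>)
    then show "(\<integral>x. \<phi> ((\<lambda>k\<in>{2..m}. x (l (k - 1)))(1 := z)) \<partial>P ?A) = proj z"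
      unfolding proj_def using shifted_tuple_in[OF l]
      by (intro integral_PiM_tuple[OF prob_space_axioms _ _ F]) auto
    have meas: "(\<lambda>x. \<lambda>k\<in>{2..m}. x (l (k - 1))) \<in> measurable (P ?A) (P {2..m})"
      using shifted_tuple_in[OF l] by (intro measurable_restrict measurable_component_singleton)
    show "integrable (P ?A) (\<lambda>x. \<phi> ((\<lambda>k\<in>{2..m}. x (l (k - 1)))(1 := z)))"
      using measurable_compose[OF meas F] upd_bound[OF z measurable_space[OF meas]]
      by (rule PA.integrable_bounded)
  qed
  have "(\<integral>x. jack_q n m \<phi> (x(a := z)) a \<partial>P ?A)
      = real (card (increasing_tuples (m - 1) ?A)) * proj z / real ((n - 1) choose (m - 1))"
    unfolding jack_q_slice[OF a] by (simp add: Bochner_Integration.integral_sum int eq del: One_nat_def restrict_upd)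
  also have "\<dots> = proj z"
    using assms by (simp add: card_increasing_tuples card)
  finally show ?thesis .
qed

lemma jack_q_slice_measurable:
  assumes a: "a \<in> {1..n}" and z: "z \<in> space \<mu>"
  shows "(\<lambda>x. jack_q n m \<phi> (x(a := z)) a) \<in> borel_measurable (P ({1..n} - {a}))"
proof -
  have "(\<lambda>w. w(a := z)) \<in> measurable (P ({1..n} - {a})) (P (insert a ({1..n} - {a})))"
    using z measurable_compose[OF measurable_Pair measurable_add_dim, of "\<lambda>w. w"
        "P ({1..n} - {a})" "{1..n} - {a}" "\<lambda>_. \<mu>" "\<lambda>_. z" a] by simp
  then have "(\<lambda>w. w(a := z)) \<in> measurable (P ({1..n} - {a})) (P {1..n})"
    using a by (simp add: insert_absorb)
  from measurable_compose[OF this jack_q_measurable[OF a]] show ?thesis .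
qed

text \<open>Condition on the own observation. The squared deviation of \<open>proj\<close>
  integrates to \<open>zeta\<close>; the conditional variance lies between 0 and the right-hand
  side, which is n - 1 times the square of the difference bound in
  \<open>jack_q_diff\<close>.\<close>

lemma expectation_jack_q_square:
  assumes "m \<le> n" "2 \<le> n" and a: "a \<in> {1..n}"
  shows "\<bar>(\<integral>x. (jack_q n m \<phi> x a - mean)\<^sup>2 \<partial>P {1..n}) - zeta \<mu> m \<phi>\<bar>
    \<le> 4 * B\<^sup>2 * (real m - 1)\<^sup>2 / (real n - 1)"
proof -
  let ?A = "{1..n} - {a}" and ?K = "4 * B\<^sup>2 * (real m - 1)\<^sup>2 / (real n - 1)"
  interpret J: product_prob_space "\<lambda>_. \<mu>" ?A by (rule product_prob)
  have ins: "insert a ?A = {1..n}" and card: "card ?A = n - 1" using a by auto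
  have n1: "0 < real n - 1" using assms(2) by simp
  define V where "V z = J.P.variance (\<lambda>x. jack_q n m \<phi> (x(a := z)) a)" for z
  have slice_bound: "\<bar>jack_q n m \<phi> (x(a := z)) a\<bar> \<le> B"
    if "x \<in> space (P ?A)" "z \<in> space \<mu>" for x z
    using upd_space[OF that, of a] unfolding ins by (intro jack_q_bound a)
  have V0: "0 \<le> V z" for z unfolding V_def by (intro integral_nonneg_AE AE_I2) simp
  have V: "V z \<le> ?K" if z: "z \<in> space \<mu>" for z
  proof -
    have "V z \<le> card ?A * (2 * B * (real m - 1) / (real n - 1))\<^sup>2"
      unfolding V_def
    proof (rule efron_stein_bounded_differences[OF prob_space_axioms _ jack_q_slice_measurable[OF a z]])
      show "\<bar>jack_q n m \<phi> (x(a := z)) a\<bar> \<le> B" if "x \<in> space (P ?A)" for x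
        by (rule slice_bound[OF that z])
      fix x i w assume x: "x \<in> space (P ?A)" and i: "i \<in> ?A" and w: "w \<in> space \<mu>"
      have "(x(i := w))(a := z) = (x(a := z))(i := w)" using i by (auto simp: fun_upd_twist)
      then show "\<bar>jack_q n m \<phi> ((x(i := w))(a := z)) a - jack_q n m \<phi> (x(a := z)) a\<bar>
          \<le> 2 * B * (real m - 1) / (real n - 1)"
        using jack_q_diff[OF assms(1) upd_space[OF x z, of a, unfolded ins] a _ _ w] i by simp
    qed auto
    also have "\<dots> = ?K" using n1 unfolding card by (simp add: power2_eq_square of_nat_diff)
    finally show ?thesis .
  qed
  \<comment> \<open>Bias-variance decomposition of the slice, whose mean is
    \<open>proj z\<close>.\<close>
  have inner: "(\<integral>x. (jack_q n m \<phi> (x(a := z)) a - mean)\<^sup>2 \<partial>P ?A) = V z + (proj z - mean)\<^sup>2"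
    if z: "z \<in> space \<mu>" for z
  proof -
    have "(\<integral>x. (jack_q n m \<phi> (x(a := z)) a - mean)\<^sup>2 \<partial>P ?A)
        = V z + (J.P.expectation (\<lambda>x. jack_q n m \<phi> (x(a := z)) a) - mean)\<^sup>2"
      unfolding V_def
      by (rule J.P.second_moment_about[OF jack_q_slice_measurable[OF a z] slice_bound[OF _ z]])
    then show ?thesis
      by (simp only: expectation_jack_q_slice[OF assms(1) a z])
  qed
  define W where "W z = (\<integral>x. (jack_q n m \<phi> (x(a := z)) a - mean)\<^sup>2 \<partial>P ?A)" for z
  have fm: "(\<lambda>x. (jack_q n m \<phi> x a - mean)\<^sup>2) \<in> borel_measurable (P (insert a ?A))"
    unfolding ins using jack_q_measurable[OF a] by measurable
  have fb: "\<bar>(jack_q n m \<phi> x a - mean)\<^sup>2\<bar> \<le> (2 * B)\<^sup>2" if "x \<in> space (P (insert a ?A))" for x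
  proof -
    have "\<bar>jack_q n m \<phi> x a - mean\<bar> \<le> \<bar>2 * B\<bar>"
      using jack_q_bound[of x n a] that a mean_bound unfolding ins by (smt (verit))
    then show ?thesis by (simp add: abs_le_square_iff)
  qed
  have outer: "(\<integral>x. (jack_q n m \<phi> x a - mean)\<^sup>2 \<partial>P {1..n}) = (\<integral>z. W z \<partial>\<mu>)"
    using J.integral_insert_rev[of ?A a, OF _ _ fm fb] unfolding ins W_def by simp
  have intp: "integrable \<mu> (\<lambda>z. (proj z - mean)\<^sup>2)"
  proof (rule integrable_bounded[where b = "(2 * B)\<^sup>2"])
    show "\<bar>(proj z - mean)\<^sup>2\<bar> \<le> (2 * B)\<^sup>2" if "z \<in> space \<mu>" for z
    proof -
      have "\<bar>proj z - mean\<bar> \<le> \<bar>2 * B\<bar>" using proj_bound[OF that] mean_bound by (smt (verit))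
      then show ?thesis by (simp add: abs_le_square_iff)
    qed
  qed (use proj_measurable in measurable)
  have Wm: "W \<in> borel_measurable \<mu>"
    unfolding W_def using measurable_compose[OF upd_pair_measurable fm]
    by (intro J.P.borel_measurable_lebesgue_integral) (simp only: case_prod_unfold)
  have bW: "(proj z - mean)\<^sup>2 \<le> W z" "W z \<le> (proj z - mean)\<^sup>2 + ?K" if "z \<in> space \<mu>" for z
    unfolding W_def inner[OF that] using V0[of z] V[OF that] by auto
  have intK: "integrable \<mu> (\<lambda>z. (proj z - mean)\<^sup>2 + ?K)"
    using intp by simp
  have intW: "integrable \<mu> W"
    by (rule Bochner_Integration.integrable_bound[OF intK Wm])
      (use bW zero_le_power2 in \<open>force intro!: AE_I2 dest: order_trans[OF zero_le_power2]\<close>)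
  have "(\<integral>z. (proj z - mean)\<^sup>2 \<partial>\<mu>) \<le> (\<integral>z. W z \<partial>\<mu>)"
    by (rule integral_mono[OF intp intW bW(1)])
  moreover have "(\<integral>z. W z \<partial>\<mu>) \<le> (\<integral>z. (proj z - mean)\<^sup>2 + ?K \<partial>\<mu>)"
    by (rule integral_mono[OF intW intK bW(2)])
  moreover have "(\<integral>z. (proj z - mean)\<^sup>2 + ?K \<partial>\<mu>) = (\<integral>z. (proj z - mean)\<^sup>2 \<partial>\<mu>) + ?K"
    using intp by (simp add: prob_space)
  ultimately show ?thesis unfolding outer zeta_eq by linarith
qed

end

section \<open>Concentration of the U-statistic and of the jackknife variance\<close>

lemma (in prob_space) Chebyshev_bounded:
  fixes f :: "'a \<Rightarrow> real"
  assumes f: "f \<in> borel_measurable M" "\<And>x. x \<in> space M \<Longrightarrow> \<bar>f x\<bar> \<le> b"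
    and "variance f \<le> v" "0 < a"
  shows "prob {x \<in> space M. a \<le> \<bar>f x - expectation f\<bar>} \<le> v / a\<^sup>2"
proof -
  have "integrable M (\<lambda>x. (f x)\<^sup>2)"
    using f by (rule integrable_square_bounded)
  from Chebyshev_inequality[OF f(1) this assms(4)] assms(3) show ?thesis
    by (smt (verit) divide_right_mono zero_le_power2)
qed

text \<open>The third conjunct bounds the bias of \<open>spread\<close>. The fourth compares the
  prefactor of \<open>jack_var\<close> with m^2 / n times a mean square: n (n - 1) / (n - m)^2 tends
  to 1, and 4 / 3 leaves room.\<close>

definition large_sample :: "nat \<Rightarrow> nat \<Rightarrow> real \<Rightarrow> real \<Rightarrow> bool" where
  "large_sample n m B r \<longleftrightarrow> m < n \<and> 2 \<le> n \<and>
    4 * B\<^sup>2 * (real m - 1)\<^sup>2 / (real n - 1) \<le> r / 24 \<and>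
    real n * (real n - 1) \<le> 4 / 3 * (real n - real m)\<^sup>2"

text \<open>Sum of three Chebyshev bounds: the U-statistic against a fraction of the signal, the
  U-statistic against a fixed tolerance, and \<open>spread\<close> against a fixed tolerance.
  Neither the laws nor the kernels appear, which gives uniformity.\<close>

definition failure_bound :: "nat \<Rightarrow> real \<Rightarrow> real \<Rightarrow> real \<Rightarrow> nat \<Rightarrow> real" where
  "failure_bound m B r L n = 16 * B\<^sup>2 / (r * L)
    + (4 * B\<^sup>2 * (real m)\<^sup>2 * (96 * B / r)\<^sup>2 + 64 * B ^ 4 * (real m)\<^sup>2 * (24 / r)\<^sup>2) / n"

context bounded_kernel
begin

text \<open>Centring at the true mean instead of the U-statistic makes the expectation an average of
  the second moments in \<open>expectation_jack_q_square\<close>; the change of centre is paid for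
  in \<open>sample_spread_near\<close>.\<close>

definition spread :: "nat \<Rightarrow> (nat \<Rightarrow> nat \<Rightarrow> real) \<Rightarrow> real" where
  "spread n x = (\<Sum>a\<in>{1..n}. (jack_q n m \<phi> x a - mean)\<^sup>2) / n"

lemma jack_q_centered_bound:
  assumes "x \<in> space (P {1..n})" "a \<in> {1..n}"
  shows "\<bar>jack_q n m \<phi> x a - mean\<bar> \<le> 2 * B" "(jack_q n m \<phi> x a - mean)\<^sup>2 \<le> 4 * B\<^sup>2"
proof -
  show *: "\<bar>jack_q n m \<phi> x a - mean\<bar> \<le> 2 * B"
    using jack_q_bound[OF assms] mean_bound by linarith
  have "\<bar>jack_q n m \<phi> x a - mean\<bar>\<^sup>2 \<le> (2 * B)\<^sup>2"
    using * by (intro power_mono) auto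
  then show "(jack_q n m \<phi> x a - mean)\<^sup>2 \<le> 4 * B\<^sup>2"
    by (simp add: power_mult_distrib)
qed

lemma spread_measurable: "spread n \<in> borel_measurable (P {1..n})"
  unfolding spread_def using jack_q_measurable
  by (intro borel_measurable_divide borel_measurable_sum borel_measurable_power
      borel_measurable_diff borel_measurable_const) auto

lemma spread_bound:
  assumes "x \<in> space (P {1..n})"
  shows "\<bar>spread n x\<bar> \<le> 4 * B\<^sup>2"
proof (cases "n = 0")
  case False
  have "(\<Sum>a\<in>{1..n}. (jack_q n m \<phi> x a - mean)\<^sup>2) \<le> (\<Sum>a\<in>{1..n}. 4 * B\<^sup>2)"
    using jack_q_centered_bound(2)[OF assms] by (intro sum_mono)
  then show ?thesis
    using False unfolding spread_def by (simp add: sum_nonneg divide_le_eq mult.commute)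
qed (simp add: spread_def)

text \<open>The sum of squares moves by at most 4 B^2 for the own component plus n - 1 terms of
  order 1/n, hence by O(1); the division by \<open>n\<close> gives the rate.\<close>

lemma spread_diff:
  assumes "m \<le> n" "2 \<le> n" and x: "x \<in> space (P {1..n})" and i: "i \<in> {1..n}" and z: "z \<in> space \<mu>"
  shows "\<bar>spread n (x(i := z)) - spread n x\<bar> \<le> 8 * B\<^sup>2 * m / n"
proof -
  let ?q = "\<lambda>x a. jack_q n m \<phi> x a - mean" and ?x' = "x(i := z)"
  have n1: "0 < real n - 1" using assms(2) by simp
  note xz = upd_space_same[OF x z i]
  have other: "\<bar>(?q ?x' a)\<^sup>2 - (?q x a)\<^sup>2\<bar> \<le> 8 * B\<^sup>2 * (real m - 1) / (real n - 1)"
    if "a \<in> {1..n} - {i}" for a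
  proof -
    have a: "a \<in> {1..n}" "i \<noteq> a" using that by auto
    have "\<bar>(?q ?x' a)\<^sup>2 - (?q x a)\<^sup>2\<bar> = \<bar>jack_q n m \<phi> ?x' a - jack_q n m \<phi> x a\<bar> * \<bar>?q ?x' a + ?q x a\<bar>"
      by (simp add: abs_mult[symmetric] power2_eq_square algebra_simps)
    also have "\<dots> \<le> (2 * B * (real m - 1) / (real n - 1)) * (4 * B)"
    proof (rule mult_mono)
      show "\<bar>jack_q n m \<phi> ?x' a - jack_q n m \<phi> x a\<bar> \<le> 2 * B * (real m - 1) / (real n - 1)"
        by (rule jack_q_diff[OF assms(1) x a(1) i a(2) z])
      show "\<bar>?q ?x' a + ?q x a\<bar> \<le> 4 * B"
        using jack_q_centered_bound(1)[OF x a(1)] jack_q_centered_bound(1)[OF xz a(1)] by linarith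
    qed (use m B n1 in auto)
    finally show ?thesis by (simp add: power2_eq_square mult_ac)
  qed
  \<comment> \<open>The own component may change completely, but both squares lie between 0 and 4
    B^2.\<close>
  have same: "\<bar>(?q ?x' i)\<^sup>2 - (?q x i)\<^sup>2\<bar> \<le> 4 * B\<^sup>2"
    using jack_q_centered_bound(2)[OF x i] jack_q_centered_bound(2)[OF xz i]
      zero_le_power2[of "?q ?x' i"] zero_le_power2[of "?q x i"] by linarith
  have "\<bar>(\<Sum>a\<in>{1..n}. (?q ?x' a)\<^sup>2) - (\<Sum>a\<in>{1..n}. (?q x a)\<^sup>2)\<bar>
      \<le> (\<Sum>a\<in>{1..n}. \<bar>(?q ?x' a)\<^sup>2 - (?q x a)\<^sup>2\<bar>)"
    unfolding sum_subtractf[symmetric] by (rule sum_abs)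
  also have "\<dots> = \<bar>(?q ?x' i)\<^sup>2 - (?q x i)\<^sup>2\<bar> + (\<Sum>a\<in>{1..n} - {i}. \<bar>(?q ?x' a)\<^sup>2 - (?q x a)\<^sup>2\<bar>)"
    using i by (intro sum.remove) auto
  also have "\<dots> \<le> 4 * B\<^sup>2 + (\<Sum>a\<in>{1..n} - {i}. 8 * B\<^sup>2 * (real m - 1) / (real n - 1))"
    using other same by (intro add_mono sum_mono)
  also have "(\<Sum>a\<in>{1..n} - {i}. 8 * B\<^sup>2 * (real m - 1) / (real n - 1)) = 8 * B\<^sup>2 * (real m - 1)"
    using i n1 by (simp add: of_nat_diff)
  also have "4 * B\<^sup>2 + 8 * B\<^sup>2 * (real m - 1) \<le> 8 * B\<^sup>2 * m"
    by (simp add: algebra_simps)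
  finally show ?thesis
    unfolding spread_def diff_divide_distrib[symmetric] abs_divide abs_of_nat
    by (rule divide_right_mono) simp
qed

lemma variance_spread:
  assumes "m \<le> n" "2 \<le> n"
  shows "prob_space.variance (P {1..n}) (spread n) \<le> 64 * B ^ 4 * (real m)\<^sup>2 / n"
proof -
  have "prob_space.variance (P {1..n}) (spread n) \<le> card {1..n} * (8 * B\<^sup>2 * m / n)\<^sup>2"
    using spread_bound spread_diff[OF assms]
    by (intro efron_stein_bounded_differences[where b = "4 * B\<^sup>2"] prob_space_axioms spread_measurable) auto
  also have "\<dots> = 64 * B ^ 4 * (real m)\<^sup>2 / n"
    using assms(2) by (simp add: power2_eq_square power4_eq_xxxx)
  finally show ?thesis .
qed

lemma expectation_spread:
  assumes "m \<le> n" "2 \<le> n"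
  shows "\<bar>(\<integral>x. spread n x \<partial>P {1..n}) - zeta \<mu> m \<phi>\<bar> \<le> 4 * B\<^sup>2 * (real m - 1)\<^sup>2 / (real n - 1)"
    (is "_ \<le> ?K")
proof -
  interpret Pn: prob_space "P {1..n}" by (rule prob_P)
  let ?E = "\<lambda>a. \<integral>x. (jack_q n m \<phi> x a - mean)\<^sup>2 \<partial>P {1..n}"
  have int: "integrable (P {1..n}) (\<lambda>x. (jack_q n m \<phi> x a - mean)\<^sup>2)" if "a \<in> {1..n}" for a
    using jack_q_measurable[OF that] jack_q_centered_bound(1)[OF _ that]
    by (intro Pn.integrable_square_bounded) auto
  have "(\<integral>x. spread n x \<partial>P {1..n}) - zeta \<mu> m \<phi> = (\<Sum>a\<in>{1..n}. ?E a - zeta \<mu> m \<phi>) / n"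
    unfolding spread_def using int assms(2)
    by (simp add: Bochner_Integration.integral_sum sum_subtractf diff_divide_distrib del: One_nat_def)
  also have "\<bar>\<dots>\<bar> \<le> (\<Sum>a\<in>{1..n}. ?K) / n"
    unfolding abs_divide using expectation_jack_q_square[OF assms]
    by (simp only: abs_of_nat) (intro divide_right_mono order_trans[OF sum_abs] sum_mono; simp)
  also have "\<dots> = ?K" using assms(2) by simp
  finally show ?thesis .
qed

text \<open>The difference of the two squares factors into \<open>?u - mean\<close> and
  \<open>2 * jack_q n m \<phi> x a - ?u - mean\<close>, and the latter is at most 4 B in absolute
  value.\<close>

lemma sample_spread_near:
  assumes x: "x \<in> space (P {1..n})" and "0 < n"
  shows "\<bar>(\<Sum>a\<in>{1..n}. (jack_q n m \<phi> x a - ustat n m \<phi> x)\<^sup>2) / n - spread n x\<bar>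
    \<le> 4 * B * \<bar>ustat n m \<phi> x - mean\<bar>"
proof -
  let ?u = "ustat n m \<phi> x"
  have "\<bar>(jack_q n m \<phi> x a - ?u)\<^sup>2 - (jack_q n m \<phi> x a - mean)\<^sup>2\<bar> \<le> 4 * B * \<bar>?u - mean\<bar>"
    if a: "a \<in> {1..n}" for a
  proof -
    have "\<bar>(jack_q n m \<phi> x a - ?u)\<^sup>2 - (jack_q n m \<phi> x a - mean)\<^sup>2\<bar>
        = \<bar>2 * jack_q n m \<phi> x a - ?u - mean\<bar> * \<bar>?u - mean\<bar>"
      unfolding abs_mult[symmetric] abs_minus_commute[of "(jack_q n m \<phi> x a - ?u)\<^sup>2"]
      by (simp add: power2_eq_square algebra_simps)
    also have "\<dots> \<le> 4 * B * \<bar>?u - mean\<bar>"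
      using jack_q_bound[OF x a] ustat_bound[OF x] mean_bound by (intro mult_right_mono) linarith+
    finally show ?thesis .
  qed
  then have "\<bar>\<Sum>a\<in>{1..n}. (jack_q n m \<phi> x a - ?u)\<^sup>2 - (jack_q n m \<phi> x a - mean)\<^sup>2\<bar>
      \<le> (\<Sum>a\<in>{1..n}. 4 * B * \<bar>?u - mean\<bar>)"
    by (intro order_trans[OF sum_abs] sum_mono)
  then show ?thesis
    using assms(2) unfolding spread_def
    by (simp add: sum_subtractf diff_divide_distrib[symmetric] field_simps)
qed

text \<open>The constant is 9/8 * 4/3 = 3/2. Strict positivity matters because a zero denominator
  would turn the studentised square into 0.\<close>

lemma jack_var_bounds:
  assumes n: "large_sample n m B r"
    and S: "\<bar>(\<Sum>a\<in>{1..n}. (jack_q n m \<phi> x a - ustat n m \<phi> x)\<^sup>2) / n - z\<bar> \<le> z / 8" and "0 < z"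
  shows "0 < jack_var n m \<phi> x" "jack_var n m \<phi> x \<le> 3 / 2 * ((real m)\<^sup>2 * z / n)"
proof -
  define S where "S = (\<Sum>a\<in>{1..n}. (jack_q n m \<phi> x a - ustat n m \<phi> x)\<^sup>2) / n"
  have mn: "0 < real n - 1" "0 < real n - real m" "0 < real n" "0 < real m"
    using n m by (auto simp: large_sample_def)
  have eq: "jack_var n m \<phi> x = (real m)\<^sup>2 / n * (real n * (real n - 1) / (real n - real m)\<^sup>2) * S"
    unfolding jack_var_def S_def using mn by (simp add: field_simps)
  have S: "0 < S" "S \<le> 9 / 8 * z"
    using assms(2,3) unfolding S_def[symmetric] by linarith+
  show "0 < jack_var n m \<phi> x" unfolding eq using mn S by simp
  have "real n * (real n - 1) / (real n - real m)\<^sup>2 \<le> 4 / 3"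
    using n mn by (simp add: large_sample_def divide_le_eq)
  then have "jack_var n m \<phi> x \<le> (real m)\<^sup>2 / n * (4 / 3) * (9 / 8 * z)"
    unfolding eq using mn S by (intro mult_mono mult_left_mono) auto
  then show "jack_var n m \<phi> x \<le> 3 / 2 * ((real m)\<^sup>2 * z / n)" by (simp add: mult_ac)
qed

lemma jackknife_concentration:
  assumes n: "large_sample n m B r" and "0 < r" and zeta: "r < zeta \<mu> m \<phi>" and "0 < L"
  obtains G where "G \<in> sets (P {1..n})" "1 - failure_bound m B r L n \<le> measure (P {1..n}) G"
    "\<And>x. x \<in> G \<Longrightarrow> \<bar>ustat n m \<phi> x - mean\<bar> \<le> sqrt L / 2 * sqrt ((real m)\<^sup>2 * zeta \<mu> m \<phi> / n)"
    "\<And>x. x \<in> G \<Longrightarrow> 0 < jack_var n m \<phi> x"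
    "\<And>x. x \<in> G \<Longrightarrow> jack_var n m \<phi> x \<le> 3 / 2 * ((real m)\<^sup>2 * zeta \<mu> m \<phi> / n)"
proof -
  interpret Pn: prob_space "P {1..n}" by (rule prob_P)
  let ?z = "zeta \<mu> m \<phi>" and ?u = "ustat n m \<phi>"
  \<comment> \<open>The tolerance is proportional to the target standard deviation, so
    \<open>m\<close> and \<open>n\<close> cancel in Chebyshev's bound and 16 B^2 / (zeta L)
    remains.\<close>
  define a where "a = sqrt L / 2 * sqrt ((real m)\<^sup>2 * ?z / n)"
  define E1 where "E1 = {x \<in> space (P {1..n}). a \<le> \<bar>?u x - mean\<bar>}"
  \<comment> \<open>Tolerance at which the recentring error of \<open>sample_spread_near\<close>
    equals r / 24.\<close>
  define E2 where "E2 = {x \<in> space (P {1..n}). r / (96 * B) \<le> \<bar>?u x - mean\<bar>}"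
  define E3 where "E3 = {x \<in> space (P {1..n}). r / 24 \<le> \<bar>spread n x - Pn.expectation (spread n)\<bar>}"
  have mn: "m \<le> n" "2 \<le> n" "0 < real n" "0 < real m" using n m by (auto simp: large_sample_def)
  have a: "0 < a" "a\<^sup>2 = L * ((real m)\<^sup>2 * ?z / n) / 4"
    using mn assms by (auto simp: a_def power_mult_distrib power_divide)
  have exp_u: "Pn.expectation ?u = mean"
    using ustat_mean_eq[OF mn(1)] by (simp add: ustat_mean_def iid_def)
  note [measurable] = ustat_measurable[of n] spread_measurable[of n]
  have E: "E1 \<in> sets (P {1..n})" "E2 \<in> sets (P {1..n})" "E3 \<in> sets (P {1..n})"
    unfolding E1_def E2_def E3_def by measurable
  have "Pn.prob E1 \<le> 4 * B\<^sup>2 * (real m)\<^sup>2 / n / a\<^sup>2"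
    unfolding E1_def
    using Pn.Chebyshev_bounded[OF ustat_measurable ustat_bound variance_ustat[OF mn(1)] a(1)]
    unfolding exp_u by simp
  also have "\<dots> = 16 * B\<^sup>2 / (?z * L)"
    unfolding a(2) using mn by (simp add: field_simps)
  also have "\<dots> \<le> 16 * B\<^sup>2 / (r * L)"
    using assms by (intro divide_left_mono mult_right_mono mult_pos_pos) auto
  finally have p1: "Pn.prob E1 \<le> 16 * B\<^sup>2 / (r * L)" .
  have "0 < r / (96 * B)" using B assms by simp
  from Pn.Chebyshev_bounded[OF ustat_measurable ustat_bound variance_ustat[OF mn(1)] this]
  have p2: "Pn.prob E2 \<le> 4 * B\<^sup>2 * (real m)\<^sup>2 * (96 * B / r)\<^sup>2 / n"
    unfolding E2_def exp_u by (simp add: power_divide field_simps)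
  have "0 < r / 24" using assms by simp
  from Pn.Chebyshev_bounded[OF spread_measurable spread_bound variance_spread[OF mn(1,2)] this]
  have p3: "Pn.prob E3 \<le> 64 * B ^ 4 * (real m)\<^sup>2 * (24 / r)\<^sup>2 / n"
    unfolding E3_def by (simp add: power_divide field_simps)
  define G where "G = space (P {1..n}) - (E1 \<union> E2 \<union> E3)"
  have "Pn.prob (E1 \<union> E2 \<union> E3) \<le> failure_bound m B r L n"
    using p1 p2 p3 measure_Un_le[OF E(1,2)]
      measure_Un_le[OF sets.Un[OF E(1,2)] E(3)]
    unfolding failure_bound_def add_divide_distrib by linarith
  then have PG: "1 - failure_bound m B r L n \<le> Pn.prob G"
    unfolding G_def using E Pn.prob_compl[of "E1 \<union> E2 \<union> E3"] by simp
  have near: "\<bar>?u x - mean\<bar> < a"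
    and S: "\<bar>(\<Sum>a\<in>{1..n}. (jack_q n m \<phi> x a - ?u x)\<^sup>2) / n - ?z\<bar> \<le> ?z / 8" if "x \<in> G" for x
  proof -
    have x: "x \<in> space (P {1..n})" using that by (simp add: G_def)
    show "\<bar>?u x - mean\<bar> < a" using that x by (auto simp: G_def E1_def)
    have u: "4 * B * \<bar>?u x - mean\<bar> \<le> r / 24"
      using that x B by (auto simp: G_def E2_def field_simps)
    have s: "\<bar>spread n x - Pn.expectation (spread n)\<bar> \<le> r / 24"
      using that x by (auto simp: G_def E3_def)
    \<comment> \<open>Bias, fluctuation of \<open>spread\<close> and recentring contribute at most r
      / 24 each; the total r / 8 is below \<open>?z / 8\<close>.\<close>
    have "4 * B\<^sup>2 * (real m - 1)\<^sup>2 / (real n - 1) \<le> r / 24"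
      using n by (simp add: large_sample_def)
    then show "\<bar>(\<Sum>a\<in>{1..n}. (jack_q n m \<phi> x a - ?u x)\<^sup>2) / n - ?z\<bar> \<le> ?z / 8"
      using u s expectation_spread[OF mn(1,2)] sample_spread_near[OF x] mn zeta by linarith
  qed
  have z: "0 < ?z" using assms by simp
  show thesis
  proof (rule that[of G])
    show "G \<in> sets (P {1..n})" unfolding G_def using E by auto
    show "1 - failure_bound m B r L n \<le> measure (P {1..n}) G" by (rule PG)
    fix x assume x: "x \<in> G"
    show "\<bar>?u x - mean\<bar> \<le> sqrt L / 2 * sqrt ((real m)\<^sup>2 * ?z / n)"
      using near[OF x] by (simp add: a_def)
    show "0 < jack_var n m \<phi> x" "jack_var n m \<phi> x \<le> 3 / 2 * ((real m)\<^sup>2 * ?z / n)"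
      using jack_var_bounds[OF n S[OF x] z] by auto
  qed
qed

end

section \<open>From one index pair to the rejection probability\<close>

lemma kernel_family_bounded_kernel:
  assumes K: "kernel_family d m q B \<Phi>" and \<mu>: "distribution_on d \<mu>"
    and "1 \<le> m" "0 < B" and ij: "i \<in> {1..q}" "j \<in> {1..q}"
  shows "bounded_kernel \<mu> m B (\<Phi> i j)"
proof -
  have sets: "sets (\<Pi>\<^sub>M l\<in>{1..m}. \<mu>) = sets (\<Pi>\<^sub>M l\<in>{1..m}. euclid d)"
    using \<mu> by (intro sets_PiM_cong refl) (simp add: distribution_on_def)
  have meas: "\<Phi> i j \<in> borel_measurable (\<Pi>\<^sub>M l\<in>{1..m}. euclid d)"
    and bound: "\<And>x. x \<in> space (\<Pi>\<^sub>M l\<in>{1..m}. euclid d) \<Longrightarrow> \<bar>\<Phi> i j x\<bar> \<le> B"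
    using K ij unfolding kernel_family_def by blast+
  show ?thesis
    unfolding bounded_kernel_def bounded_kernel_axioms_def
    using \<mu> assms(3,4) meas bound
    by (simp add: distribution_on_def measurable_cong_sets[OF sets refl] sets_eq_imp_space_eq[OF sets]
        del: One_nat_def)
qed

text \<open>Makes the rejection event measurable, so that its probability can be bounded below by
  that of a smaller event.\<close>

lemma max_stat_measurable:
  assumes K: "kernel_family d m q B \<Phi>" and \<mu>: "distribution_on d \<mu>" and \<nu>: "distribution_on d \<nu>"
    and "1 \<le> m" "0 < B"
  shows "(\<lambda>\<omega>. max_stat n1 n2 m q \<Phi> (fst \<omega>) (snd \<omega>)) \<in> borel_measurable (iid \<mu> n1 \<Otimes>\<^sub>M iid \<nu> n2)"
proof -
  have u: "ustat n m (\<Phi> i j) \<in> borel_measurable (iid \<rho> n)"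
    and v: "jack_var n m (\<Phi> i j) \<in> borel_measurable (iid \<rho> n)"
    if "i \<in> {1..q}" "j \<in> {1..q}" "distribution_on d \<rho>" for i j n \<rho>
  proof -
    interpret bounded_kernel \<rho> m B "\<Phi> i j"
      using K that assms(4,5) by (intro kernel_family_bounded_kernel)
    show "ustat n m (\<Phi> i j) \<in> borel_measurable (iid \<rho> n)"
      unfolding iid_def by (rule ustat_measurable)
    show "jack_var n m (\<Phi> i j) \<in> borel_measurable (iid \<rho> n)"
      unfolding iid_def jack_var_def
      by (intro borel_measurable_times borel_measurable_sum borel_measurable_power
          borel_measurable_diff borel_measurable_const ustat_measurable jack_q_measurable)
  qed
  show ?thesis
    unfolding max_stat_def case_prod_unfold
    by (intro borel_measurable_Max borel_measurable_divide borel_measurable_power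
        borel_measurable_diff borel_measurable_add
        measurable_compose[OF measurable_fst u[OF _ _ \<mu>]]
        measurable_compose[OF measurable_snd u[OF _ _ \<nu>]]
        measurable_compose[OF measurable_fst v[OF _ _ \<mu>]]
        measurable_compose[OF measurable_snd v[OF _ _ \<nu>]]) auto
qed

text \<open>In units of sqrt L * sqrt (s1 + s2) the signal is 4 and each sample loses at most 1/2,
  which leaves 3; then 3^2 / (3/2) = 6.\<close>

lemma studentized_difference_ge:
  fixes s1 s2 v1 v2 L :: real
  assumes signal: "4 * sqrt L * sqrt (s1 + s2) \<le> \<bar>u1 - u2\<bar>"
    and e1: "\<bar>x1 - u1\<bar> \<le> sqrt L / 2 * sqrt s1" and e2: "\<bar>x2 - u2\<bar> \<le> sqrt L / 2 * sqrt s2"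
    and v: "0 < v1" "0 < v2" "v1 \<le> 3 / 2 * s1" "v2 \<le> 3 / 2 * s2" and "0 < L"
  shows "6 * L \<le> (x1 - x2)\<^sup>2 / (v1 + v2)"
proof -
  have s: "0 < s1" "0 < s2" using v by linarith+
  have "sqrt L / 2 * sqrt s1 \<le> sqrt L / 2 * sqrt (s1 + s2)"
    "sqrt L / 2 * sqrt s2 \<le> sqrt L / 2 * sqrt (s1 + s2)"
    using s assms(8) by (auto intro!: mult_left_mono)
  then have "3 * (sqrt L * sqrt (s1 + s2)) \<le> \<bar>x1 - x2\<bar>"
    using signal e1 e2 by linarith
  then have "(3 * (sqrt L * sqrt (s1 + s2)))\<^sup>2 \<le> \<bar>x1 - x2\<bar>\<^sup>2"
    using s assms(8) by (intro power_mono) auto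
  then have bound: "9 * L * (s1 + s2) \<le> (x1 - x2)\<^sup>2"
    using s assms(8) by (simp add: power_mult_distrib)
  have "6 * L * (v1 + v2) \<le> 6 * L * (3 / 2 * (s1 + s2))"
    using v assms(8) by (intro mult_left_mono) auto
  also have "\<dots> = 9 * L * (s1 + s2)" by (simp add: algebra_simps)
  also note bound
  finally show ?thesis
    using v by (simp add: le_divide_eq)
qed

text \<open>The samples are independent, so the product of the two good events has the product
  probability, and on it the index pair of maximal signal alone forces rejection. The lower bound is
  the same for all alternatives.\<close>

lemma rejection_prob_ge:
  assumes K: "kernel_family d m q B \<Phi>" and "1 \<le> m" "0 < B" "0 < r1" "0 < r2"
    and alt: "(\<mu>, \<nu>) \<in> alternatives n1 n2 d m q \<Phi> r1 r2 4"
    and q: "2 \<le> q" and n1: "large_sample n1 m B r1" and n2: "large_sample n2 m B r2"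
    and thr: "gumbel_quantile \<alpha> + 4 * ln (real q) - ln (ln (real q)) \<le> 6 * ln (real q)"
  shows "1 - failure_bound m B r1 (ln q) n1 - failure_bound m B r2 (ln q) n2
    \<le> rejection_prob \<alpha> n1 n2 m q \<Phi> \<mu> \<nu>"
proof -
  let ?L = "ln (real q)" and ?Q = "{1..q} \<times> {1..q}"
  let ?f1 = "failure_bound m B r1 ?L n1" and ?f2 = "failure_bound m B r2 ?L n2"
  have L: "0 < ?L" using q by simp
  have \<mu>: "distribution_on d \<mu>" and \<nu>: "distribution_on d \<nu>"
    and zeta: "\<And>i j. i \<in> {1..q} \<Longrightarrow> j \<in> {1..q} \<Longrightarrow> r1 < zeta \<mu> m (\<Phi> i j) \<and> r2 < zeta \<nu> m (\<Phi> i j)"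
    using alt by (auto simp: alternatives_def)
  define R where "R = (\<lambda>(i, j). \<bar>ustat_mean \<mu> n1 m (\<Phi> i j) - ustat_mean \<nu> n2 m (\<Phi> i j)\<bar>
      / sqrt ((real m)\<^sup>2 * zeta \<mu> m (\<Phi> i j) / real n1 + (real m)\<^sup>2 * zeta \<nu> m (\<Phi> i j) / real n2))"
  have fin: "finite (R ` ?Q)" "R ` ?Q \<noteq> {}" using q by auto
  have "4 * sqrt ?L \<le> Max (R ` ?Q)"
    using alt by (simp add: alternatives_def signal_class_def R_def)
  with Max_in[OF fin] obtain i j where ij: "i \<in> {1..q}" "j \<in> {1..q}" and Rij: "4 * sqrt ?L \<le> R (i, j)"
    by (smt (verit) imageE mem_Sigma_iff surj_pair)
  interpret X: bounded_kernel \<mu> m B "\<Phi> i j"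
    using K \<mu> assms(2,3) ij by (rule kernel_family_bounded_kernel)
  interpret Y: bounded_kernel \<nu> m B "\<Phi> i j"
    using K \<nu> assms(2,3) ij by (rule kernel_family_bounded_kernel)
  interpret PX: prob_space "iid \<mu> n1" unfolding iid_def by (rule X.prob_P)
  interpret PY: prob_space "iid \<nu> n2" unfolding iid_def by (rule Y.prob_P)
  interpret XY: pair_prob_space "iid \<mu> n1" "iid \<nu> n2" ..
  define s1 s2 where "s1 = (real m)\<^sup>2 * zeta \<mu> m (\<Phi> i j) / n1" and "s2 = (real m)\<^sup>2 * zeta \<nu> m (\<Phi> i j) / n2"
  have n: "m \<le> n1" "m \<le> n2" "0 < real n1" "0 < real n2"
    using n1 n2 assms(2) by (auto simp: large_sample_def)
  have s: "0 < s1" "0 < s2"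
    using zeta[OF ij] n assms(2,4,5) by (auto simp: s1_def s2_def)
  have signal: "4 * sqrt ?L * sqrt (s1 + s2) \<le> \<bar>X.mean - Y.mean\<bar>"
    using Rij s unfolding R_def by (simp add: s1_def[symmetric] s2_def[symmetric]
        X.ustat_mean_eq[OF n(1)] Y.ustat_mean_eq[OF n(2)] le_divide_eq)
  obtain G1 where G1: "G1 \<in> sets (iid \<mu> n1)" "1 - ?f1 \<le> PX.prob G1"
    "\<And>x. x \<in> G1 \<Longrightarrow> \<bar>ustat n1 m (\<Phi> i j) x - X.mean\<bar> \<le> sqrt ?L / 2 * sqrt s1"
    "\<And>x. x \<in> G1 \<Longrightarrow> 0 < jack_var n1 m (\<Phi> i j) x"
    "\<And>x. x \<in> G1 \<Longrightarrow> jack_var n1 m (\<Phi> i j) x \<le> 3 / 2 * s1"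
    using X.jackknife_concentration[OF n1 assms(4) conjunct1[OF zeta[OF ij]] L]
    unfolding iid_def s1_def by metis
  obtain G2 where G2: "G2 \<in> sets (iid \<nu> n2)" "1 - ?f2 \<le> PY.prob G2"
    "\<And>y. y \<in> G2 \<Longrightarrow> \<bar>ustat n2 m (\<Phi> i j) y - Y.mean\<bar> \<le> sqrt ?L / 2 * sqrt s2"
    "\<And>y. y \<in> G2 \<Longrightarrow> 0 < jack_var n2 m (\<Phi> i j) y"
    "\<And>y. y \<in> G2 \<Longrightarrow> jack_var n2 m (\<Phi> i j) y \<le> 3 / 2 * s2"
    using Y.jackknife_concentration[OF n2 assms(5) conjunct2[OF zeta[OF ij]] L]
    unfolding iid_def s2_def by metis
  let ?thr = "gumbel_quantile \<alpha> + 4 * ?L - ln ?L"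
  have reject: "?thr \<le> max_stat n1 n2 m q \<Phi> x y" if x: "x \<in> G1" and y: "y \<in> G2" for x y
  proof -
    have "6 * ?L \<le> (ustat n1 m (\<Phi> i j) x - ustat n2 m (\<Phi> i j) y)\<^sup>2
        / (jack_var n1 m (\<Phi> i j) x + jack_var n2 m (\<Phi> i j) y)"
      by (rule studentized_difference_ge[OF signal G1(3)[OF x] G2(3)[OF y] G1(4)[OF x] G2(4)[OF y]
            G1(5)[OF x] G2(5)[OF y] L])
    also have "\<dots> \<le> max_stat n1 n2 m q \<Phi> x y"
      unfolding max_stat_def using ij by (intro Max_ge) (auto intro!: image_eqI[where x = "(i, j)"])
    finally show ?thesis using thr by linarith
  qed
  define E where "E = {\<omega> \<in> space (iid \<mu> n1 \<Otimes>\<^sub>M iid \<nu> n2).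
      ?thr \<le> max_stat n1 n2 m q \<Phi> (fst \<omega>) (snd \<omega>)}"
  have E: "E \<in> sets (iid \<mu> n1 \<Otimes>\<^sub>M iid \<nu> n2)"
    unfolding E_def using max_stat_measurable[OF K \<mu> \<nu> assms(2,3)] by measurable
  have "PX.prob G1 * PY.prob G2 = XY.prob (G1 \<times> G2)"
    by (simp add: measure_def PY.emeasure_pair_measure_Times[OF G1(1) G2(1)] enn2real_mult)
  also have "\<dots> \<le> XY.prob E"
  proof (rule XY.finite_measure_mono[OF _ E])
    show "G1 \<times> G2 \<subseteq> E"
      using reject sets.sets_into_space[OF G1(1)] sets.sets_into_space[OF G2(1)]
      by (auto simp: E_def space_pair_measure)
  qed
  also have "\<dots> = rejection_prob \<alpha> n1 n2 m q \<Phi> \<mu> \<nu>"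
    unfolding rejection_prob_def E_def max_test_def case_prod_unfold
    by (intro arg_cong[where f = XY.prob] Collect_cong) simp
  finally have "PX.prob G1 * PY.prob G2 \<le> rejection_prob \<alpha> n1 n2 m q \<Phi> \<mu> \<nu>" .
  \<comment> \<open>Expansion of (1 - p) (1 - p') \<ge> 0. Being linear, it combines with the lower
    bounds on p and p' even when these are negative.\<close>
  moreover have "PX.prob G1 + PY.prob G2 - 1 \<le> PX.prob G1 * PY.prob G2"
    using mult_nonneg_nonneg[of "1 - PX.prob G1" "1 - PY.prob G2"] by (simp add: algebra_simps)
  ultimately show ?thesis using G1(2) G2(2) by linarith
qed

section \<open>Passage to the limit\<close>

lemma eventually_large_sample:
  assumes "0 < r"
  shows "eventually (\<lambda>n. large_sample n m B r) sequentially"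
proof -
  have "filterlim (\<lambda>n. real n - 1) at_top sequentially"
    by real_asymp
  then have "(\<lambda>n. 4 * B\<^sup>2 * (real m - 1)\<^sup>2 / (real n - 1)) \<longlonglongrightarrow> 0"
    by (intro tendsto_divide_0[OF tendsto_const] filterlim_at_top_imp_at_infinity)
  then have "eventually (\<lambda>n. 4 * B\<^sup>2 * (real m - 1)\<^sup>2 / (real n - 1) < r / 24) sequentially"
    using assms by (intro order_tendstoD) auto
  moreover have "eventually (\<lambda>n. real n * (real n - 1) \<le> 4 / 3 * (real n - real m)\<^sup>2) sequentially"
    by real_asymp
  ultimately show ?thesis
    using eventually_gt_at_top[of m] eventually_ge_at_top[of 2]
    by eventually_elim (simp add: large_sample_def)
qed

lemma failure_bound_tendsto_0:
  assumes "filterlim N at_top F" "filterlim L at_top F" "0 < r"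
  shows "((\<lambda>t. failure_bound m B r (L t) (N t)) \<longlongrightarrow> 0) F"
proof -
  have "filterlim (\<lambda>t. real (N t)) at_top F"
    using assms(1) by (rule filterlim_compose[OF filterlim_real_sequentially])
  then show ?thesis
    unfolding failure_bound_def
    by (intro tendsto_add_zero tendsto_divide_0[OF tendsto_const] filterlim_at_top_imp_at_infinity
        filterlim_tendsto_pos_mult_at_top[OF tendsto_const] assms)
qed

theorem theorem2p4:
  fixes \<alpha> \<epsilon> r1 r2 B :: real
    and m :: nat
    and n1 n2 n d q :: "nat \<Rightarrow> nat"
    and \<Phi> :: "nat \<Rightarrow> nat \<Rightarrow> nat \<Rightarrow> kernel"
  assumes "0 < \<alpha>" "\<alpha> < 1"
    and "0 < \<epsilon>" "\<epsilon> < 1 / 3"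
    and "0 < r1" "0 < r2"
    and "1 \<le> m"
    and "\<And>t. n t = max (n1 t) (n2 t)"
    and "\<And>t. kernel_family (d t) m (q t) B (\<Phi> t)"
    and "filterlim n at_top sequentially"
    and "filterlim q at_top sequentially"
    and "(\<lambda>t. real (n1 t)) \<in> \<Theta>(\<lambda>t. real (n2 t))"
    and "(\<lambda>t. real (n2 t)) \<in> \<Theta>(\<lambda>t. real (n t))"
    and "(\<lambda>t. ln (real (q t))) \<in> O(\<lambda>t. real (n t) powr (1 / 3 - \<epsilon>))"
  shows "(\<lambda>t. unit_Inf
            ((\<lambda>(\<mu>, \<nu>). rejection_prob \<alpha> (n1 t) (n2 t) m (q t) (\<Phi> t) \<mu> \<nu>)
              ` alternatives (n1 t) (n2 t) (d t) m (q t) (\<Phi> t) r1 r2 4))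
         \<longlonglongrightarrow> 1"
proof -
  \<comment> \<open>The bound \<open>B\<close> carries no sign condition, while
    \<open>bounded_kernel\<close> needs a positive one.\<close>
  define B' where "B' = max B 1"
  have B': "0 < B'" by (simp add: B'_def)
  have K: "kernel_family (d t) m (q t) B' (\<Phi> t)" for t
    using assms(9)[of t] unfolding kernel_family_def B'_def by (fastforce intro: le_max_iff_disj[THEN iffD2])
  have n_real: "filterlim (\<lambda>t. real (n t)) at_top sequentially"
    using assms(10) by (rule filterlim_compose[OF filterlim_real_sequentially])
  \<comment> \<open>\<open>n\<close> is the larger sample size, so its divergence says nothing about
    the smaller one; comparability transfers it to both.\<close>
  have big: "filterlim f at_top sequentially"
    if "(\<lambda>t. real (f t)) \<in> \<Theta>(\<lambda>t. real (n t))" for f :: "nat \<Rightarrow> nat"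
  proof -
    have "(\<lambda>t. real (n t)) \<in> O(\<lambda>t. real (f t))"
      using that by (simp add: bigtheta_sym bigthetaD1)
    then obtain c where c: "0 < c" "eventually (\<lambda>t. real (n t) \<le> c * real (f t)) sequentially"
      by (auto elim!: landau_o.bigE)
    have "filterlim (\<lambda>t. real (f t)) at_top sequentially"
    proof (rule filterlim_at_top_mono)
      show "filterlim (\<lambda>t. 1 / c * real (n t)) at_top sequentially"
        using c(1) n_real by (intro filterlim_tendsto_pos_mult_at_top[OF tendsto_const]) auto
      show "eventually (\<lambda>t. 1 / c * real (n t) \<le> real (f t)) sequentially"
        using c(2) by eventually_elim (use c(1) in \<open>simp add: field_simps\<close>)
    qed
    then show ?thesis by (simp add: filterlim_sequentially_iff_filterlim_real)
  qed
  have n2: "filterlim n2 at_top sequentially" by (rule big[OF assms(13)])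
  have n1: "filterlim n1 at_top sequentially"
    by (rule big[OF landau_theta.trans[OF assms(12,13)]])
  have L: "filterlim (\<lambda>t. ln (real (q t))) at_top sequentially"
    by (intro filterlim_compose[OF ln_at_top] filterlim_compose[OF filterlim_real_sequentially] assms(11))
  let ?err = "\<lambda>t. failure_bound m B' r1 (ln (q t)) (n1 t) + failure_bound m B' r2 (ln (q t)) (n2 t)"
  let ?p = "\<lambda>t. unit_Inf ((\<lambda>(\<mu>, \<nu>). rejection_prob \<alpha> (n1 t) (n2 t) m (q t) (\<Phi> t) \<mu> \<nu>)
      ` alternatives (n1 t) (n2 t) (d t) m (q t) (\<Phi> t) r1 r2 4)"
  have err: "?err \<longlonglongrightarrow> 0"
    using failure_bound_tendsto_0[OF n1 L assms(5)] failure_bound_tendsto_0[OF n2 L assms(6)]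
    by (rule tendsto_add_zero)
  have lower: "eventually (\<lambda>t. 1 - ?err t \<le> ?p t) sequentially"
  proof -
    \<comment> \<open>The quantile is a constant, and 2 x + ln x eventually exceeds it.\<close>
    have "eventually (\<lambda>x. gumbel_quantile \<alpha> + 4 * x - ln x \<le> 6 * x) at_top"
      by real_asymp
    then have thr: "eventually (\<lambda>t. gumbel_quantile \<alpha> + 4 * ln (real (q t)) - ln (ln (real (q t)))
        \<le> 6 * ln (real (q t))) sequentially"
      using L by (rule eventually_compose_filterlim)
    have "eventually (\<lambda>t. 2 \<le> q t) sequentially"
      using assms(11) by (simp add: filterlim_at_top)
    moreover have "eventually (\<lambda>t. large_sample (n1 t) m B' r1) sequentially"
      "eventually (\<lambda>t. large_sample (n2 t) m B' r2) sequentially"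
      using eventually_compose_filterlim[OF eventually_large_sample n1]
        eventually_compose_filterlim[OF eventually_large_sample n2] assms(5,6) by auto
    moreover have "eventually (\<lambda>t. -1 < ?err t) sequentially" "eventually (\<lambda>t. ?err t < 1) sequentially"
      using order_tendstoD[OF err] by auto
    ultimately show ?thesis using thr
    proof eventually_elim
      case (elim t)
      \<comment> \<open>Nonnegativity puts 1 - \<open>?err t\<close> below the element 1 inserted by
        \<open>unit_Inf\<close>, which also settles an empty set of alternatives.\<close>
      have "0 \<le> failure_bound m B' r1 (ln (q t)) (n1 t)" "0 \<le> failure_bound m B' r2 (ln (q t)) (n2 t)"
        using assms(5,6) elim(1) by (auto simp: failure_bound_def)
      moreover have "1 - ?err t \<le> rejection_prob \<alpha> (n1 t) (n2 t) m (q t) (\<Phi> t) \<mu> \<nu>"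
        if "(\<mu>, \<nu>) \<in> alternatives (n1 t) (n2 t) (d t) m (q t) (\<Phi> t) r1 r2 4" for \<mu> \<nu>
        using rejection_prob_ge[OF K assms(7) B' assms(5,6) that elim(1-3) elim(6)] by simp
      ultimately show ?case
        unfolding unit_Inf_def by (intro cInf_greatest) auto
    qed
  qed
  have upper: "?p t \<le> 1" for t
    unfolding unit_Inf_def
    by (intro cInf_lower) (auto intro!: bdd_belowI[where m = 0] simp: rejection_prob_def)
  have lim: "(\<lambda>t. 1 - ?err t) \<longlonglongrightarrow> 1"
    using tendsto_diff[OF tendsto_const err, of 1] by simp
  show ?thesis
    using upper by (intro real_tendsto_sandwich[OF lower _ lim tendsto_const]) simp
qed

end
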